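(* Let $\theta\ge e$ and $k\in\{1,2\}$. (A) For every holomorphic $\phi:\mathbb{D}\to\mathbb{D}$ and every weight $\mu$ on $\mathbb{D}$: $C_\phi:\mathcal{B}^{\log}_{k,\theta}\to\mathcal{B}^{\mu}$ is bounded (i.e. $C_\phi$ maps $\mathcal{B}^{\log}_{k,\theta}$ into $\mathcal{B}^\mu$ and is a bounded operator) if and only if $\sup_{j\in\mathbb{N}}\frac{\|\phi^j\|_\mu}{\|F_j\|_{\log}}<\infty$, if and only if $\sup_{j\in\mathbb{N}}\frac{\|\phi^j\|_\mu}{\log(j+1)}<\infty$. (B) For every holomorphic $\phi:\mathbb{D}\to\mathbb{D}$ and every weight $\mu$ on $\mathbb{D}$: $C_\phi:\mathcal{B}^{\log}_{k,\theta}\to\mathcal{B}^{\mu}$ is compact (i.e. $C_\phi$ maps $\mathcal{B}^{\log}_{k,\theta}$ into $\mathcal{B}^\mu$ and is a compact operator) if and only if $\lim_{j\to\infty}\frac{\|\phi^j\|_\mu}{\|F_j\|_{\log}}=0$, if and only if $\lim_{j\to\infty}\frac{\|\phi^j\|_\mu}{\log(j+1)}=0$. (C) There is a constant $K>0$ such that for every holomorphic $\phi:\mathbb{D}\to\mathbb{D}$ and every weight $\mu$ on $\mathbb{D}$ such that $C_\phi$ maps $\mathcal{B}^{\log}_{k,\theta}$ into $\mathcal{B}^{\mu}$, the three quantities $$\|C_\phi\|_e^{\mathcal{B}^{\log}_{k,\theta}\to\mathcal{B}^{\mu}},\qquad \limsup_{j\to\infty}\frac{\|\phi^j\|_\mu}{\|F_j\|_{\log}},\qquad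 \limsup_{j\to\infty}\frac{\|\phi^j\|_\mu}{\log(j+1)}$$ are equivalent with constant $K$, i.e. any two of them, $A$ and $B$, satisfy $\frac1K A\le B\le KA$.
   Context: $\mathbb{D}$ is the open unit disk in $\mathbb{C}$, $\mathcal{H}(\mathbb{D})$ the space of holomorphic functions on $\mathbb{D}$, $\mathbb{N}=\{1,2,3,\dots\}$, and $\log$ is the natural logarithm. A weight on $\mathbb{D}$ is a bounded, continuous, strictly positive function $\mu:\mathbb{D}\to(0,\infty)$. For a weight $\mu$ and $f\in\mathcal{H}(\mathbb{D})$, put $\|f\|_\mu:=\sup_{z\in\mathbb{D}}\mu(z)|f'(z)|\in[0,\infty]$; the $\mu$-Bloch space $\mathcal{B}^\mu$ is the set of $f\in\mathcal{H}(\mathbb{D})$ with $\|f\|_\mu<\infty$, a Banach space under the norm $\|f\|_{\mathcal{B}^\mu}:=|f(0)|+\|f\|_\mu$. For $\theta>1$ and $k\in\{1,2\}$, the $(k,\theta)$-log Bloch space $\mathcal{B}^{\log}_{k,\theta}=\mathcal{B}^{\log}_{k,\theta}(\mathbb{D})$ is $\mathcal{B}^\mu$ for the weight $\mu(z)=v_\theta^{(k)}(z):=(1-|z|^k)\log\frac{\theta}{1-|z|^k}$. $\|\cdot\|_{\log}$ denotes the seminorm $\|\cdot\|_{v_{\log}}$ for the weight $v_{\log}(z)=(1-|z|)\log\left(\frac{3}{1-|z|}\right)$ (that is, $v_{\log}=v_3^{(1)}$). $C_\phi f:=f\circ\phi$ is the composition operator with symbol $\phi$. $F_j(z):=z^j$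 on $\mathbb{D}$, and $\phi^j$ is the pointwise $j$th power of $\phi$. For a bounded linear operator $T:X\to Y$ between normed linear spaces, the essential norm is $\|T\|_e^{X\to Y}:=\inf\{\|T-S\| : S:X\to Y \text{ compact linear}\}$, with $\|\cdot\|$ the operator norm.
   Formalization: In (B), each limit condition also requires that the quotient be finite for every j≥1; without this the equivalence fails, e.g. for φ(z)=√(1−z)/2 and μ=1, where ‖φ‖_μ=∞ although both limits are 0. *)

theory Defs
  imports "HOL-Complex_Analysis.Complex_Analysis"
begin

abbreviation unit_disc :: "complex set"
  where "unit_disc \<equiv> ball 0 1"

definition weight :: "(complex \<Rightarrow> real) \<Rightarrow> bool"
  where "weight \<mu> \<longleftrightarrow>
    continuous_on unit_disc \<mu> \<and> bounded (\<mu> ` unit_disc) \<and> (\<forall>z\<in>unit_disc. 0 < \<mu> z)"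

(* A function on the disc is represented by its extension by 0 to the whole plane, so that
   equality in the function space is equality of functions on the disc. *)
definition hol_disc :: "(complex \<Rightarrow> complex) set"
  where "hol_disc = {f. f holomorphic_on unit_disc \<and> (\<forall>z. z \<notin> unit_disc \<longrightarrow> f z = 0)}"

(* Only the values of f on the (open) disc matter, so this may be applied directly to
   functions that are not extended by 0, such as powers of the identity or of a symbol. *)
definition bloch_seminorm :: "(complex \<Rightarrow> real) \<Rightarrow> (complex \<Rightarrow> complex) \<Rightarrow> ennreal"
  where "bloch_seminorm \<mu> f = (SUP z\<in>unit_disc. ennreal (\<mu> z * cmod (deriv f z)))"

definition bloch_space :: "(complex \<Rightarrow> real) \<Rightarrow> (complex \<Rightarrow> complex) set"
  where "bloch_space \<mu> = {f \<in> hol_disc. bloch_seminorm \<mu> f < \<infinity>}"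

definition bloch_norm :: "(complex \<Rightarrow> real) \<Rightarrow> (complex \<Rightarrow> complex) \<Rightarrow> real"
  where "bloch_norm \<mu> f = cmod (f 0) + enn2real (bloch_seminorm \<mu> f)"

definition bloch_dist :: "(complex \<Rightarrow> real) \<Rightarrow> (complex \<Rightarrow> complex) \<Rightarrow> (complex \<Rightarrow> complex) \<Rightarrow> real"
  where "bloch_dist \<mu> f g = bloch_norm \<mu> (\<lambda>z. f z - g z)"

definition bloch_topology :: "(complex \<Rightarrow> real) \<Rightarrow> (complex \<Rightarrow> complex) topology"
  where "bloch_topology \<mu> = Metric_space.mtopology (bloch_space \<mu>) (bloch_dist \<mu>)"

definition log_weight :: "nat \<Rightarrow> real \<Rightarrow> complex \<Rightarrow> real"
  where "log_weight k \<theta> z = (1 - cmod z ^ k) * ln (\<theta> / (1 - cmod z ^ k))"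

definition comp_op :: "(complex \<Rightarrow> complex) \<Rightarrow> (complex \<Rightarrow> complex) \<Rightarrow> (complex \<Rightarrow> complex)"
  where "comp_op \<phi> f = (\<lambda>z. if z \<in> unit_disc then f (\<phi> z) else 0)"

type_synonym operator = "(complex \<Rightarrow> complex) \<Rightarrow> (complex \<Rightarrow> complex)"

(* In the following, operators act from the Bloch space of the weight nu to that of mu. *)

definition linear_op :: "(complex \<Rightarrow> real) \<Rightarrow> (complex \<Rightarrow> real) \<Rightarrow> operator \<Rightarrow> bool"
  where "linear_op \<nu> \<mu> T \<longleftrightarrow>
    T ` bloch_space \<nu> \<subseteq> bloch_space \<mu> \<and>
    (\<forall>f\<in>bloch_space \<nu>. \<forall>g\<in>bloch_space \<nu>. \<forall>a b.
       T (\<lambda>z. a * f z + b * g z) = (\<lambda>z. a * T f z + b * T g z))"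

definition bounded_op :: "(complex \<Rightarrow> real) \<Rightarrow> (complex \<Rightarrow> real) \<Rightarrow> operator \<Rightarrow> bool"
  where "bounded_op \<nu> \<mu> T \<longleftrightarrow>
    linear_op \<nu> \<mu> T \<and> (\<exists>C. \<forall>f\<in>bloch_space \<nu>. bloch_norm \<mu> (T f) \<le> C * bloch_norm \<nu> f)"

definition unit_ball :: "(complex \<Rightarrow> real) \<Rightarrow> (complex \<Rightarrow> complex) set"
  where "unit_ball \<nu> = {f \<in> bloch_space \<nu>. bloch_norm \<nu> f \<le> 1}"

definition compact_op :: "(complex \<Rightarrow> real) \<Rightarrow> (complex \<Rightarrow> real) \<Rightarrow> operator \<Rightarrow> bool"
  where "compact_op \<nu> \<mu> T \<longleftrightarrow>
    linear_op \<nu> \<mu> T \<and>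
    compactin (bloch_topology \<mu>) (bloch_topology \<mu> closure_of (T ` unit_ball \<nu>))"

definition op_norm :: "(complex \<Rightarrow> real) \<Rightarrow> (complex \<Rightarrow> real) \<Rightarrow> operator \<Rightarrow> ennreal"
  where "op_norm \<nu> \<mu> T = (SUP f\<in>unit_ball \<nu>. ennreal (bloch_norm \<mu> (T f)))"

definition ess_norm :: "(complex \<Rightarrow> real) \<Rightarrow> (complex \<Rightarrow> real) \<Rightarrow> operator \<Rightarrow> ennreal"
  where "ess_norm \<nu> \<mu> T = (INF S\<in>{S. compact_op \<nu> \<mu> S}. op_norm \<nu> \<mu> (\<lambda>f z. T f z - S f z))"

definition equiv_const :: "real \<Rightarrow> ennreal \<Rightarrow> ennreal \<Rightarrow> bool"
  where "equiv_const K A B \<longleftrightarrow> ennreal (1 / K) * A \<le> B \<and> B \<le> ennreal K * A"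

(* The metric topology above is only meaningful because the Bloch distance is a metric. *)

lemma weight_log_weight:
  assumes "exp 1 \<le> \<theta>" "0 < k"
  shows "weight (log_weight k \<theta>)"
proof -
  have th: "\<theta> > 1" using assms(1) exp_gt_one[of "1::real"] by linarith
  have x: "0 < 1 - cmod z ^ k \<and> 1 - cmod z ^ k \<le> 1" if "z \<in> unit_disc" for z
    using that assms(2) by (auto simp: power_less_one_iff)
  have pos: "0 < log_weight k \<theta> z" if "z \<in> unit_disc" for z
    using x[OF that] th
    by (auto simp: log_weight_def intro!: mult_pos_pos ln_gt_zero le_less_trans[of "1 - cmod z ^ k" 1 \<theta>])
  have bd: "log_weight k \<theta> z \<le> \<theta>" if "z \<in> unit_disc" for z
  proof -
    let ?x = "1 - cmod z ^ k"
    have "ln (\<theta> / ?x) \<le> \<theta> / ?x"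
      using x[OF that] th ln_less_self[of "\<theta> / ?x"] by (auto intro: less_imp_le)
    then have "?x * ln (\<theta> / ?x) \<le> ?x * (\<theta> / ?x)"
      using x[OF that] by (intro mult_left_mono) auto
    also have "\<dots> = \<theta>" using x[OF that] by auto
    finally show ?thesis by (simp add: log_weight_def)
  qed
  have "continuous_on unit_disc (log_weight k \<theta>)"
    unfolding log_weight_def using x th by (fastforce intro!: continuous_intros)
  moreover have "bounded (log_weight k \<theta> ` unit_disc)"
    unfolding bounded_iff using pos bd by (intro exI[of _ \<theta>]) (auto simp: abs_of_pos)
  ultimately show ?thesis using pos by (auto simp: weight_def)
qed

lemma bloch_seminorm_triangle:
  assumes "f holomorphic_on unit_disc" "g holomorphic_on unit_disc"
    and "\<forall>z\<in>unit_disc. 0 < \<mu> z"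
  shows "bloch_seminorm \<mu> (\<lambda>z. f z + g z) \<le> bloch_seminorm \<mu> f + bloch_seminorm \<mu> g"
  unfolding bloch_seminorm_def
proof (rule SUP_least)
  fix z assume z: "z \<in> unit_disc"
  have d: "deriv (\<lambda>z. f z + g z) z = deriv f z + deriv g z"
    using z assms(1,2) by (intro deriv_add holomorphic_on_imp_differentiable_at) auto
  have "\<mu> z * cmod (deriv f z + deriv g z) \<le> \<mu> z * cmod (deriv f z) + \<mu> z * cmod (deriv g z)"
    using assms(3) z by (metis distrib_left less_imp_le mult_left_mono norm_triangle_ineq)
  then have "ennreal (\<mu> z * cmod (deriv (\<lambda>z. f z + g z) z))
      \<le> ennreal (\<mu> z * cmod (deriv f z)) + ennreal (\<mu> z * cmod (deriv g z))"
    using assms(3) z unfolding d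
    by (subst ennreal_plus[symmetric])
       (auto intro!: ennreal_leI mult_nonneg_nonneg simp: less_imp_le simp del: ennreal_plus)
  also have "\<dots> \<le> (SUP z\<in>unit_disc. ennreal (\<mu> z * cmod (deriv f z)))
       + (SUP z\<in>unit_disc. ennreal (\<mu> z * cmod (deriv g z)))"
    using z by (intro add_mono SUP_upper)
  finally show "ennreal (\<mu> z * cmod (deriv (\<lambda>z. f z + g z) z)) \<le> \<dots>" .
qed

lemma bloch_seminorm_uminus:
  assumes "f holomorphic_on unit_disc"
  shows "bloch_seminorm \<mu> (\<lambda>z. - f z) = bloch_seminorm \<mu> f"
  unfolding bloch_seminorm_def
proof (rule SUP_cong)
  fix z assume "z \<in> unit_disc"
  then have "deriv (\<lambda>z. - f z) z = - deriv f z"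
    using assms by (intro deriv_minus holomorphic_on_imp_differentiable_at) auto
  then show "ennreal (\<mu> z * cmod (deriv (\<lambda>z. - f z) z)) = ennreal (\<mu> z * cmod (deriv f z))"
    by simp
qed simp

lemma bloch_space_diff:
  assumes "\<forall>z\<in>unit_disc. 0 < \<mu> z" "f \<in> bloch_space \<mu>" "g \<in> bloch_space \<mu>"
  shows "(\<lambda>z. f z - g z) \<in> bloch_space \<mu>"
proof -
  have h: "f holomorphic_on unit_disc" "g holomorphic_on unit_disc" "(\<lambda>z. - g z) holomorphic_on unit_disc"
    using assms by (auto simp: bloch_space_def hol_disc_def intro!: holomorphic_intros)
  have "bloch_seminorm \<mu> (\<lambda>z. f z + - g z) \<le> bloch_seminorm \<mu> f + bloch_seminorm \<mu> g"
    using bloch_seminorm_triangle[OF h(1,3) assms(1)] bloch_seminorm_uminus[OF h(2)] by simp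
  also have "\<dots> < \<infinity>" using assms by (auto simp: bloch_space_def)
  finally show ?thesis using assms h
    by (auto simp: bloch_space_def hol_disc_def intro!: holomorphic_intros)
qed

lemma Metric_space_bloch:
  assumes "weight \<mu>"
  shows "Metric_space (bloch_space \<mu>) (bloch_dist \<mu>)"
proof
  have mu: "\<forall>z\<in>unit_disc. 0 < \<mu> z" using assms by (simp add: weight_def)
  fix f g h
  show "0 \<le> bloch_dist \<mu> f g" by (simp add: bloch_dist_def bloch_norm_def)
  have "cmod (deriv (\<lambda>z. f z - g z) z) = cmod (deriv (\<lambda>z. g z - f z) z)" for z
  proof (cases "(\<lambda>z. g z - f z) field_differentiable at z")
    case True
    then show ?thesis using deriv_minus[OF True] by simp
  next
    case False
    have "\<not> (\<lambda>z. f z - g z) field_differentiable at z"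
      using False field_differentiable_minus[of "\<lambda>z. f z - g z" "at z"] by auto
    then show ?thesis using False by (simp add: deriv_def field_differentiable_def)
  qed
  then show "bloch_dist \<mu> f g = bloch_dist \<mu> g f"
    by (simp add: bloch_dist_def bloch_norm_def bloch_seminorm_def norm_minus_commute)
next
  have mu: "\<forall>z\<in>unit_disc. 0 < \<mu> z" using assms by (simp add: weight_def)
  fix f g
  assume fg: "f \<in> bloch_space \<mu>" "g \<in> bloch_space \<mu>"
  let ?d = "\<lambda>z. f z - g z"
  have d: "?d \<in> bloch_space \<mu>" using bloch_space_diff[OF mu fg] .
  show "bloch_dist \<mu> f g = 0 \<longleftrightarrow> f = g"
  proof
    assume "bloch_dist \<mu> f g = 0"
    then have z: "?d 0 = 0" "enn2real (bloch_seminorm \<mu> ?d) = 0"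
      by (auto simp: bloch_dist_def bloch_norm_def add_nonneg_eq_0_iff)
    then have "bloch_seminorm \<mu> ?d = 0"
      using d by (auto simp: bloch_space_def enn2real_eq_0_iff)
    then have "ennreal (\<mu> z * cmod (deriv ?d z)) \<le> 0" if "z \<in> unit_disc" for z
      using SUP_upper[OF that, of "\<lambda>z. ennreal (\<mu> z * cmod (deriv ?d z))"]
      by (simp add: bloch_seminorm_def)
    then have "\<forall>z\<in>unit_disc. deriv ?d z = 0"
      using mu by (force simp: ennreal_eq_0_iff mult_le_0_iff)
    then have "\<forall>z\<in>unit_disc. (?d has_field_derivative 0) (at z)"
      using d by (metis (no_types, lifting) bloch_space_def hol_disc_def holomorphic_derivI mem_Collect_eq open_ball)
    then have "\<exists>c. \<forall>z\<in>unit_disc. ?d z = c"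
      by (intro has_field_derivative_zero_constant) (auto simp: has_field_derivative_at_within)
    then have "\<forall>z\<in>unit_disc. ?d z = 0" using z(1) by (metis centre_in_ball zero_less_one)
    then show "f = g" using fg by (force simp: bloch_space_def hol_disc_def)
  qed (simp add: bloch_dist_def bloch_norm_def bloch_seminorm_def)
next
  have mu: "\<forall>z\<in>unit_disc. 0 < \<mu> z" using assms by (simp add: weight_def)
  fix f g h
  assume A: "f \<in> bloch_space \<mu>" "g \<in> bloch_space \<mu>" "h \<in> bloch_space \<mu>"
  note d1 = bloch_space_diff[OF mu A(1,2)] and d2 = bloch_space_diff[OF mu A(2,3)]
  have "bloch_seminorm \<mu> (\<lambda>z. (f z - g z) + (g z - h z))
      \<le> bloch_seminorm \<mu> (\<lambda>z. f z - g z) + bloch_seminorm \<mu> (\<lambda>z. g z - h z)"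
    using d1 d2 mu by (intro bloch_seminorm_triangle) (auto simp: bloch_space_def hol_disc_def)
  then have "enn2real (bloch_seminorm \<mu> (\<lambda>z. f z - h z))
      \<le> enn2real (bloch_seminorm \<mu> (\<lambda>z. f z - g z) + bloch_seminorm \<mu> (\<lambda>z. g z - h z))"
    using d1 d2 by (intro enn2real_mono) (auto simp: bloch_space_def)
  also have "\<dots> = enn2real (bloch_seminorm \<mu> (\<lambda>z. f z - g z)) + enn2real (bloch_seminorm \<mu> (\<lambda>z. g z - h z))"
    using d1 d2 by (intro enn2real_plus) (auto simp: bloch_space_def)
  finally show "bloch_dist \<mu> f h \<le> bloch_dist \<mu> f g + bloch_dist \<mu> g h"
    using norm_triangle_ineq[of "f 0 - g 0" "g 0 - h 0"] by (simp add: bloch_dist_def bloch_norm_def)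
qed
end

theory Submission
  imports Defs
begin

text \<open>Write \<open>\<nu>\<close> for the logarithmic weight and \<open>\<phi>\<close> for the symbol. Since
\<open>(f \<circ> \<phi>)' = (f' \<circ> \<phi>) \<phi>'\<close>, everything is decided by the quotient
\<open>Q z = \<mu> z |\<phi>' z| / \<nu> (\<phi> z)\<close>: the composition operator is bounded if \<open>Q\<close> is bounded, it is
compact if moreover \<open>Q z\<close> becomes small when \<open>|\<phi> z|\<close> is close to 1 (Montel's theorem disposes of
the part of the disc where \<open>|\<phi> z|\<close> stays away from 1), and its essential norm is at most twice the
upper limit of \<open>Q\<close> for \<open>|\<phi> z|\<close> tending to 1.

The powers of \<open>\<phi>\<close> measure \<open>Q\<close>, because \<open>\<phi>\<^sup>j\<close> has derivative
\<open>j \<phi>\<^bsup>j-1\<^esup> \<phi>'\<close>. If \<open>r = |\<phi> z|\<close> and \<open>j\<close> is the integer part of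
\<open>1 / (1 - r)\<close>, then \<open>r\<^bsup>j-1\<^esup> \<ge> 1/e\<close>, so \<open>j r\<^bsup>j-1\<^esup>\<close> is comparable to
\<open>1 / (1 - r)\<close> while \<open>ln (j + 1)\<close> is at most \<open>ln (\<theta> / (1 - r))\<close>. Hence a bound
\<open>\<parallel>\<phi>\<^sup>j\<parallel> \<le> M ln (j + 1)\<close> at this single \<open>j\<close> already gives \<open>Q z \<le> 2 e M\<close> (lemma
\<open>symbol_bound\<close>).

For the converse estimates the monomials are divided by a constant multiple of \<open>ln (j + 1)\<close>, which
puts them into the unit ball of the source space, and the operator maps them to the scaled powers of
\<open>\<phi>\<close>. This settles boundedness. For compactness and the essential norm one needs that every
compact operator sends these scaled monomials to a null sequence (lemma \<open>compact_op_null\<close>).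
Instead of weak convergence and a description of the dual space, the proof uses a gliding hump: the
mass \<open>\<nu> |f'|\<close> of a scaled monomial sits near the circle of radius \<open>1 - 1/j\<close>, so from any infinite set
of indices one can choose arbitrarily many whose monomials have a sum of norm at most 2. If
infinitely many images stayed away from 0, then, by total boundedness, infinitely many of them would
lie close to one nonzero vector, and the images of such sums would have norms proportional to
the number of summands, although the sums themselves stay bounded.

Finally the norm of the monomial of degree \<open>j\<close> is comparable to \<open>ln (j + 1)\<close>, which makes the two
normalisations of \<open>\<parallel>\<phi>\<^sup>j\<parallel>\<close> interchangeable.\<close>

section \<open>The logarithmic weight as a function of the radius\<close>

text \<open>The derivative of \<open>x ln (\<theta> / x)\<close> is \<open>ln (\<theta> / x) - 1\<close>, nonnegative on the unit interval as soon as
\<open>\<theta> \<ge> e\<close>: the reason for requiring this of \<open>\<theta>\<close>. Calculus is replaced by \<open>ln t \<le> t - 1\<close>.\<close>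

lemma x_ln_mono:
  fixes x y \<theta> :: real
  assumes "exp 1 \<le> \<theta>" "0 < x" "x \<le> y" "y \<le> 1"
  shows "x * ln (\<theta> / x) \<le> y * ln (\<theta> / y)"
proof -
  have th: "\<theta> > 0" using assms(1) exp_gt_zero[of "1::real"] by linarith
  have "exp 1 \<le> \<theta> / y"
    using assms th by (simp add: le_divide_eq)
      (smt (verit) exp_gt_zero mult_left_le)
  then have one: "1 \<le> ln (\<theta> / y)"
    using assms th by (subst ln_ge_iff) auto
  have "ln (y / x) \<le> y / x - 1" using assms by (intro ln_le_minus_one) auto
  then have "x * ln (y / x) \<le> x * (y / x - 1)" using assms by (intro mult_left_mono) auto
  also have "\<dots> = y - x" using assms by (simp add: field_simps)
  also have "\<dots> \<le> (y - x) * ln (\<theta> / y)" using one assms mult_left_mono[of 1 _ "y - x"] by simp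
  finally have "x * ln (y / x) \<le> (y - x) * ln (\<theta> / y)" .
  moreover have "ln (\<theta> / x) = ln (\<theta> / y) + ln (y / x)"
    using assms th by (simp add: ln_div)
  ultimately show ?thesis by (simp add: algebra_simps)
qed

lemma log_weight_antimono:
  assumes "exp 1 \<le> \<theta>" "0 < k" "cmod z \<le> cmod w" "cmod w < 1"
  shows "log_weight k \<theta> w \<le> log_weight k \<theta> z"
proof -
  have "cmod z ^ k \<le> cmod w ^ k" using assms by (intro power_mono) auto
  moreover have "cmod w ^ k < 1" using assms by (simp add: power_less_one_iff)
  ultimately show ?thesis unfolding log_weight_def
    using assms by (intro x_ln_mono) auto
qed

text \<open>For \<open>k = 2\<close> one has \<open>1 - r \<le> 1 - r\<^sup>2 \<le> 2 (1 - r)\<close>, so both weights are comparable to the same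
one-dimensional profile; all later estimates refer to that profile only.\<close>

lemma log_weight_bounds:
  assumes "exp 1 \<le> \<theta>" "k \<in> {1, 2}" "cmod z < 1"
  shows "(1 - cmod z) * ln (\<theta> / (1 - cmod z)) \<le> log_weight k \<theta> z"
    and "log_weight k \<theta> z \<le> 2 * ((1 - cmod z) * ln (\<theta> / (1 - cmod z)))"
proof -
  define x y where "x = 1 - cmod z" and "y = 1 - cmod z ^ k"
  have th: "\<theta> > 1" using assms(1) exp_gt_one[of "1::real"] by linarith
  have xy: "0 < x" "x \<le> y" "y \<le> 1" "y \<le> 2 * x"
    using assms(2,3) mult_left_le[of "cmod z" "cmod z"]
      zero_le_square[of "1 - cmod z"]
    by (auto simp: x_def y_def power2_eq_square algebra_simps)
  show "(1 - cmod z) * ln (\<theta> / (1 - cmod z)) \<le> log_weight k \<theta> z"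
    using x_ln_mono[OF assms(1) xy(1-3)] by (simp add: log_weight_def x_def y_def)
  have "y * ln (\<theta> / y) \<le> y * ln (\<theta> / x)"
    using xy th by (intro mult_left_mono) (auto simp: ln_div)
  also have "\<dots> \<le> 2 * x * ln (\<theta> / x)"
    using xy th by (intro mult_right_mono) (auto simp: ln_div)
  finally show "log_weight k \<theta> z \<le> 2 * ((1 - cmod z) * ln (\<theta> / (1 - cmod z)))"
    by (simp only: log_weight_def x_def y_def mult.assoc)
qed

text \<open>The classical bound \<open>(1 + 1/n)\<^sup>n \<le> e\<close> for \<open>n = j - 1\<close>, read backwards. For \<open>j = 1\<close> the
power is 1.\<close>

lemma exp_le_power:
  fixes r :: real
  assumes "1 \<le> j" "1 - 1 / real j \<le> r"
  shows "exp (-1) \<le> r ^ (j - 1)"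
proof (cases "j = 1")
  case False
  define n where "n = real (j - 1)"
  have n: "n > 0" "real j = n + 1" using False assms by (auto simp: n_def)
  have "(1 + 1 / n) ^ (j - 1) \<le> exp (1 / n) ^ (j - 1)"
    using n by (intro power_mono exp_ge_add_one_self) auto
  also have "\<dots> = exp 1" using n by (simp add: exp_of_nat_mult[symmetric] n_def)
  finally have "exp (-1) \<le> inverse ((1 + 1 / n) ^ (j - 1))"
    using n by (simp add: exp_minus add_pos_pos le_imp_inverse_le)
  also have "\<dots> = (1 - 1 / real j) ^ (j - 1)"
    using n by (simp add: power_inverse[symmetric] field_simps)
  also have "\<dots> \<le> r ^ (j - 1)" using assms n by (intro power_mono) auto
  finally show ?thesis .
qed auto

text \<open>Substitute \<open>t = j (1 - r)\<close>. Then \<open>r\<^bsup>j-1\<^esup> \<le> exp (1 - t)\<close>, the logarithm splits as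
\<open>ln \<theta> + ln j - ln t\<close>, and both \<open>t exp (- t)\<close> and \<open>- t ln t\<close> are bounded by 1. The constant terms
are absorbed into \<open>ln (j + 1)\<close>, which is at least \<open>1/2\<close>.\<close>

lemma monomial_profile_upper:
  fixes r \<theta> :: real
  assumes "1 < \<theta>" "1 \<le> j" "0 \<le> r" "r < 1"
  shows "(1 - r) * ln (\<theta> / (1 - r)) * (real j * r ^ (j - 1))
         \<le> (2 * exp 1 * ln \<theta> + exp 1 + 2) * ln (real j + 1)"
proof -
  define x t p where "x = 1 - r" and "t = real j * x" and "p = r ^ (j - 1)"
  have x: "0 < x" "x \<le> 1" and t: "0 < t" using assms by (auto simp: x_def t_def)
  have p: "0 \<le> p" "p \<le> 1" using assms by (auto simp: p_def power_le_one)
  have "p \<le> exp (- x) ^ (j - 1)"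
    unfolding p_def using assms exp_ge_add_one_self[of "- x"]
    by (intro power_mono) (auto simp: x_def)
  also have "\<dots> = exp (x - t)"
    using assms by (simp add: exp_of_nat_mult[symmetric] t_def of_nat_diff algebra_simps)
  also have "\<dots> \<le> exp (1 - t)" using x by simp
  finally have "t * p \<le> t * exp (1 - t)" using t by (intro mult_left_mono) auto
  also have "\<dots> = exp 1 * (t / exp t)" by (simp add: exp_diff)
  also have "\<dots> \<le> exp 1 * 1"
    using exp_ge_add_one_self[of t] t
    by (intro mult_left_mono) (simp_all add: divide_le_eq del: exp_ge_add_one_self)
  finally have tp: "t * p \<le> exp 1" by simp
  have "t * ln (1 / t) \<le> t * (1 / t)"
    using t ln_le_minus_one[of "1 / t"] by (intro mult_left_mono) auto
  then have "t * ln (1 / t) \<le> 1" using t by simp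
  then have tl: "t * ln (1 / t) * p \<le> 1"
    using p mult_right_mono[of "t * ln (1 / t)" 1 p] by linarith
  have half: "1 / 2 \<le> ln (real j + 1)"
  proof -
    have "1 / 2 \<le> ln (2::real)" using ln_le_minus_one[of "1 / 2 :: real"] by (simp add: ln_div)
    also have "\<dots> \<le> ln (real j + 1)" using assms by simp
    finally show ?thesis .
  qed
  have lj: "ln (real j) \<le> ln (real j + 1)" "0 \<le> ln (real j)" using assms by auto
  have lt: "0 < ln \<theta>" using assms by simp
  have "ln (\<theta> / x) = ln \<theta> + ln (real j) + ln (1 / t)"
    using x assms by (simp add: t_def ln_div ln_mult)
  then have "x * ln (\<theta> / x) * (real j * p)
      = (t * p) * (ln \<theta> + ln (real j)) + t * ln (1 / t) * p"
    by (simp add: t_def algebra_simps)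
  also have "\<dots> \<le> exp 1 * (ln \<theta> + ln (real j)) + 1"
    using tp tl lj lt by (intro add_mono mult_right_mono) auto
  also have "\<dots> \<le> exp 1 * (ln \<theta> * (2 * ln (real j + 1)) + ln (real j + 1)) + 2 * ln (real j + 1)"
    using half lj lt by (intro add_mono mult_left_mono) auto
  also have "\<dots> = (2 * exp 1 * ln \<theta> + exp 1 + 2) * ln (real j + 1)"
    by (simp add: algebra_simps)
  finally show ?thesis by (simp add: x_def p_def)
qed

lemma ex_nat_near_inverse:
  fixes r :: real
  assumes "0 \<le> r" "r < 1"
  obtains j :: nat where "1 \<le> j" "real j \<le> 1 / (1 - r)" "1 / (1 - r) < real j + 1"
proof
  define a where "a = 1 / (1 - r)"
  have a: "1 \<le> a" using assms by (simp add: a_def)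
  show "1 \<le> nat \<lfloor>a\<rfloor>" "real (nat \<lfloor>a\<rfloor>) \<le> 1 / (1 - r)" "1 / (1 - r) < real (nat \<lfloor>a\<rfloor>) + 1"
    unfolding a_def[symmetric] using a by (auto simp: le_nat_iff le_floor_iff)
qed

text \<open>The two hypotheses on \<open>j\<close> say that \<open>j\<close> is the integer part of \<open>1 / (1 - r)\<close>. They give
\<open>1 \<le> 2 j (1 - r)\<close>, \<open>1 \<le> e r\<^bsup>j-1\<^esup>\<close> and \<open>ln (j + 1) \<le> ln (\<theta> / (1 - r))\<close>, which are multiplied.\<close>

lemma monomial_profile_lower:
  fixes r \<theta> :: real
  assumes "2 \<le> \<theta>" "1 \<le> j" "0 \<le> r" "r < 1" "real j \<le> 1 / (1 - r)" "1 / (1 - r) < real j + 1"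
  shows "ln (real j + 1) \<le> 2 * exp 1 * ((1 - r) * ln (\<theta> / (1 - r))) * (real j * r ^ (j - 1))"
proof -
  have x: "1 / (real j + 1) < 1 - r" "1 - r \<le> 1 / real j"
    using assms by (auto simp: field_simps)
  have "real j + 1 \<le> 2 / (1 - r)" using assms by (simp add: field_simps)
  also have "\<dots> \<le> \<theta> / (1 - r)" using assms by (intro divide_right_mono) auto
  finally have l: "ln (real j + 1) \<le> ln (\<theta> / (1 - r))"
    using assms by (subst ln_le_cancel_iff) auto
  have "1 \<le> 2 * real j * (1 - r)"
  proof -
    have "1 \<le> 2 * real j * (1 / (real j + 1))" using assms by (simp add: field_simps)
    also have "\<dots> \<le> 2 * real j * (1 - r)" using x by (intro mult_left_mono) auto
    finally show ?thesis .
  qed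
  moreover have "1 \<le> exp 1 * r ^ (j - 1)"
    using exp_le_power[of j r] x assms by (simp add: exp_minus field_simps)
  ultimately have "1 * 1 \<le> (2 * real j * (1 - r)) * (exp 1 * r ^ (j - 1))"
    by (intro mult_mono) auto
  then have "ln (real j + 1) * 1 \<le> ln (\<theta> / (1 - r)) * ((2 * real j * (1 - r)) * (exp 1 * r ^ (j - 1)))"
    using l assms by (intro mult_mono) auto
  then show ?thesis by (simp add: algebra_simps)
qed

text \<open>A crude quantitative form of the fact that the weight vanishes at the boundary of the disc.\<close>

lemma log_weight_le_sqrt:
  assumes "exp 1 \<le> \<theta>" "k \<in> {1, 2}" "cmod z < 1"
  shows "log_weight k \<theta> z \<le> 4 * sqrt (\<theta> * (1 - cmod z))"
proof -
  define x where "x = 1 - cmod z"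
  have x: "0 < x" using assms by (simp add: x_def)
  have th: "\<theta> > 0" using assms(1) exp_gt_zero[of "1::real"] by linarith
  have "ln (\<theta> / x) = 2 * ln (sqrt (\<theta> / x))" using x th by (simp add: ln_sqrt)
  also have "\<dots> \<le> 2 * sqrt (\<theta> / x)"
    using x th ln_le_minus_one[of "sqrt (\<theta> / x)"] by simp
  finally have "x * ln (\<theta> / x) \<le> x * (2 * sqrt (\<theta> / x))"
    using x by (intro mult_left_mono) auto
  also have "\<dots> = 2 * sqrt (\<theta> * x)"
  proof -
    have "x * sqrt (\<theta> / x) = sqrt (x\<^sup>2) * sqrt (\<theta> / x)" using x by simp
    also have "\<dots> = sqrt (\<theta> * x)"
      unfolding real_sqrt_mult[symmetric] using x by (simp add: power2_eq_square)
    finally show ?thesis by simp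
  qed
  finally show ?thesis using log_weight_bounds(2)[OF assms] by (simp add: x_def)
qed

section \<open>Bloch spaces\<close>

lemma bloch_seminorm_le_iff:
  assumes "0 \<le> b"
  shows "bloch_seminorm \<mu> f \<le> ennreal b \<longleftrightarrow> (\<forall>z\<in>unit_disc. \<mu> z * cmod (deriv f z) \<le> b)"
  using assms by (simp add: bloch_seminorm_def SUP_le_iff)

lemma bloch_seminorm_cong:
  assumes "\<And>z. z \<in> unit_disc \<Longrightarrow> f z = g z"
  shows "bloch_seminorm \<mu> f = bloch_seminorm \<mu> g"
  unfolding bloch_seminorm_def
proof (rule SUP_cong)
  fix z assume "z \<in> unit_disc"
  then have "\<forall>\<^sub>F w in nhds z. f w = g w"
    using assms by (auto simp: eventually_nhds intro!: exI[of _ unit_disc])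
  then show "ennreal (\<mu> z * cmod (deriv f z)) = ennreal (\<mu> z * cmod (deriv g z))"
    by (simp cong: deriv_cong_ev)
qed simp

lemma bloch_spaceI:
  assumes "f \<in> hol_disc" "\<And>z. z \<in> unit_disc \<Longrightarrow> \<mu> z * cmod (deriv f z) \<le> b"
  shows "f \<in> bloch_space \<mu>"
proof -
  have "bloch_seminorm \<mu> f \<le> ennreal (max b 0)"
    using assms by (subst bloch_seminorm_le_iff) (auto intro: le_max_iff_disj[THEN iffD2])
  then show ?thesis using assms by (auto simp: bloch_space_def intro: le_less_trans)
qed

lemma bloch_norm_le:
  assumes "cmod (f 0) \<le> a" "\<And>z. z \<in> unit_disc \<Longrightarrow> \<mu> z * cmod (deriv f z) \<le> b" "0 \<le> b"
  shows "bloch_norm \<mu> f \<le> a + b"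
proof -
  have "bloch_seminorm \<mu> f \<le> ennreal b" using assms by (simp add: bloch_seminorm_le_iff)
  then have "enn2real (bloch_seminorm \<mu> f) \<le> b" using assms(3) by (rule enn2real_leI[rotated])
  then show ?thesis using assms by (simp add: bloch_norm_def)
qed

text \<open>Together with \<open>bloch_norm_le\<close> this replaces the supremum, which is taken in the extended
nonnegative reals, by pointwise estimates of real numbers.\<close>

lemma bloch_normD:
  assumes "f \<in> bloch_space \<mu>" "z \<in> unit_disc"
  shows "cmod (f 0) + \<mu> z * cmod (deriv f z) \<le> bloch_norm \<mu> f"
proof -
  have "ennreal (\<mu> z * cmod (deriv f z)) \<le> bloch_seminorm \<mu> f"
    unfolding bloch_seminorm_def using assms by (intro SUP_upper)
  then have "\<mu> z * cmod (deriv f z) \<le> enn2real (bloch_seminorm \<mu> f)"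
    using assms by (cases "bloch_seminorm \<mu> f") (auto simp: bloch_space_def ennreal_le_iff2)
  then show ?thesis by (simp add: bloch_norm_def)
qed

lemma bloch_norm_nonneg: "0 \<le> bloch_norm \<mu> f"
  by (simp add: bloch_norm_def)

lemma bloch_seminorm_le_norm:
  assumes "f \<in> bloch_space \<mu>"
  shows "bloch_seminorm \<mu> f \<le> ennreal (bloch_norm \<mu> f)"
  using assms by (cases "bloch_seminorm \<mu> f") (auto simp: bloch_space_def bloch_norm_def)

lemma bloch_space_holomorphic: "f \<in> bloch_space \<mu> \<Longrightarrow> f holomorphic_on unit_disc"
  by (simp add: bloch_space_def hol_disc_def)

lemma deriv_lincomb:
  assumes "f holomorphic_on unit_disc" "g holomorphic_on unit_disc" "z \<in> unit_disc"
  shows "deriv (\<lambda>z. a * f z + b * g z) z = a * deriv f z + b * deriv g z"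
proof -
  have d: "f field_differentiable at z" "g field_differentiable at z"
    using assms by (auto intro!: holomorphic_on_imp_differentiable_at)
  have "((\<lambda>z. a * f z + b * g z) has_field_derivative a * deriv f z + b * deriv g z) (at z)"
    using d by (auto intro!: derivative_eq_intros DERIV_deriv_iff_field_differentiable[THEN iffD2])
  then show ?thesis by (rule DERIV_imp_deriv)
qed

lemma bloch_lincomb:
  assumes "weight \<mu>" "f \<in> bloch_space \<mu>" "g \<in> bloch_space \<mu>"
  shows "(\<lambda>z. a * f z + b * g z) \<in> bloch_space \<mu>"
    and "bloch_norm \<mu> (\<lambda>z. a * f z + b * g z) \<le> cmod a * bloch_norm \<mu> f + cmod b * bloch_norm \<mu> g"
proof -
  let ?h = "\<lambda>z. a * f z + b * g z"
  let ?A = "cmod a * enn2real (bloch_seminorm \<mu> f) + cmod b * enn2real (bloch_seminorm \<mu> g)"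
  have d: "\<mu> z * cmod (deriv ?h z) \<le> ?A" if z: "z \<in> unit_disc" for z
  proof -
    have \<mu>: "0 < \<mu> z" using assms(1) z by (simp add: weight_def)
    have "\<mu> z * cmod (deriv ?h z) \<le> \<mu> z * (cmod a * cmod (deriv f z) + cmod b * cmod (deriv g z))"
      using \<mu> deriv_lincomb[OF assms(2,3)[THEN bloch_space_holomorphic] z, of a b]
        norm_triangle_ineq[of "a * deriv f z" "b * deriv g z"]
      by (intro mult_left_mono) (simp_all add: norm_mult)
    also have "\<dots> = cmod a * (\<mu> z * cmod (deriv f z)) + cmod b * (\<mu> z * cmod (deriv g z))"
      by (simp add: algebra_simps)
    also have "\<dots> \<le> ?A"
      using bloch_normD[OF assms(2) z] bloch_normD[OF assms(3) z]
      by (intro add_mono mult_left_mono) (auto simp: bloch_norm_def)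
    finally show ?thesis .
  qed
  show "?h \<in> bloch_space \<mu>"
    using assms d by (intro bloch_spaceI[of _ _ ?A])
      (auto simp: hol_disc_def bloch_space_def intro!: holomorphic_intros)
  have "bloch_norm \<mu> ?h \<le> cmod (?h 0) + ?A" using d by (intro bloch_norm_le) auto
  also have "cmod (?h 0) \<le> cmod a * cmod (f 0) + cmod b * cmod (g 0)"
    by (metis norm_mult norm_triangle_ineq)
  finally show "bloch_norm \<mu> ?h \<le> cmod a * bloch_norm \<mu> f + cmod b * bloch_norm \<mu> g"
    by (simp add: bloch_norm_def algebra_simps)
qed

lemma bloch_diff:
  assumes "weight \<mu>" "f \<in> bloch_space \<mu>" "g \<in> bloch_space \<mu>"
  shows "(\<lambda>z. f z - g z) \<in> bloch_space \<mu>"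
    and "bloch_norm \<mu> f \<le> bloch_norm \<mu> (\<lambda>z. f z - g z) + bloch_norm \<mu> g"
proof -
  show d: "(\<lambda>z. f z - g z) \<in> bloch_space \<mu>"
    using bloch_lincomb(1)[OF assms, of 1 "-1"] by simp
  show "bloch_norm \<mu> f \<le> bloch_norm \<mu> (\<lambda>z. f z - g z) + bloch_norm \<mu> g"
    using bloch_lincomb(2)[OF assms(1) d assms(3), of 1 1] by simp
qed

text \<open>Cauchy's estimate on the disc of radius \<open>s' - s\<close> about \<open>w\<close>.\<close>

lemma deriv_bound_of_bound:
  assumes "h holomorphic_on unit_disc" "\<And>z. cmod z \<le> s' \<Longrightarrow> cmod (h z) \<le> \<delta>"
    "s < s'" "s' < 1" "cmod w \<le> s"
  shows "cmod (deriv h w) \<le> \<delta> / (s' - s)"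
proof -
  have sub: "cball w (s' - s) \<subseteq> unit_disc"
  proof
    fix x assume "x \<in> cball w (s' - s)"
    then show "x \<in> unit_disc"
      using assms(4,5) norm_triangle_ineq2[of x w] by (simp add: dist_norm norm_minus_commute)
  qed
  have "cmod ((deriv ^^ 1) h w) \<le> fact 1 * \<delta> / (s' - s) ^ 1"
  proof (rule Cauchy_inequality)
    show "h holomorphic_on ball w (s' - s)"
      using assms(1) subset_trans[OF ball_subset_cball sub] by (rule holomorphic_on_subset)
    show "continuous_on (cball w (s' - s)) h"
      using assms(1) sub holomorphic_on_imp_continuous_on holomorphic_on_subset by blast
    fix x assume "cmod (w - x) = s' - s"
    then have "cmod x \<le> s'" using assms(5) norm_triangle_ineq2[of x w] by (simp add: norm_minus_commute)
    then show "cmod (h x) \<le> \<delta>" by (rule assms(2))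
  qed (use assms(3) in simp)
  then show ?thesis by simp
qed

lemma holomorphic_lipschitz_cball:
  assumes "h holomorphic_on unit_disc" "s < 1"
    "\<And>z. cmod z \<le> s \<Longrightarrow> cmod (deriv h z) \<le> B" "cmod z \<le> s" "cmod w \<le> s"
  shows "cmod (h z - h w) \<le> B * cmod (z - w)"
proof (rule field_differentiable_bound[of "cball 0 s" h "deriv h"])
  show "convex (cball (0::complex) s)" by simp
  show "(h has_field_derivative deriv h x) (at x within cball 0 s)" if "x \<in> cball 0 s" for x
    using that assms(2) by (intro has_field_derivative_at_within[OF holomorphic_derivI[OF assms(1)]]) auto
  show "cmod (deriv h x) \<le> B" if "x \<in> cball 0 s" for x
    using that by (intro assms(3)) simp
qed (use assms(4,5) in simp_all)

text \<open>Monotonicity in the radius is used in two ways: a bound for \<open>\<nu> |f'|\<close> controls \<open>f'\<close> on a whole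
smaller disc by the value of \<open>\<nu>\<close> on its boundary circle, and replacing a point by one nearer to the
origin does not decrease the weight.\<close>

locale radial_weight =
  fixes \<nu> :: "complex \<Rightarrow> real"
  assumes weight: "weight \<nu>"
    and antimono: "cmod z \<le> cmod w \<Longrightarrow> cmod w < 1 \<Longrightarrow> \<nu> w \<le> \<nu> z"
begin

lemma pos: "cmod z < 1 \<Longrightarrow> 0 < \<nu> z"
  using weight by (simp add: weight_def)

lemma deriv_bound:
  assumes "f \<in> bloch_space \<nu>" "cmod z \<le> s" "s < 1" "0 \<le> s"
  shows "cmod (deriv f z) \<le> bloch_norm \<nu> f / \<nu> (of_real s)"
proof -
  have "\<nu> (of_real s) * cmod (deriv f z) \<le> \<nu> z * cmod (deriv f z)"
    using assms by (intro mult_right_mono antimono) auto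
  also have "\<dots> \<le> bloch_norm \<nu> f"
    using bloch_normD[OF assms(1), of z] norm_ge_zero[of "f 0"] assms(2,3)
    by (simp del: norm_ge_zero)
  finally show ?thesis using pos[of "of_real s"] assms by (simp add: field_simps)
qed

lemma lipschitz_cball:
  assumes "f \<in> bloch_space \<nu>" "cmod z \<le> s" "cmod w \<le> s" "s < 1"
  shows "cmod (f z - f w) \<le> bloch_norm \<nu> f / \<nu> (of_real s) * cmod (z - w)"
proof (rule holomorphic_lipschitz_cball[OF bloch_space_holomorphic[OF assms(1)] assms(4) _ assms(2,3)])
  fix x assume "cmod x \<le> s"
  then show "cmod (deriv f x) \<le> bloch_norm \<nu> f / \<nu> (of_real s)"
    by (rule deriv_bound[OF assms(1) _ assms(4) order_trans[OF norm_ge_zero assms(2)]])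
qed

end

lemma radial_weight_log_weight:
  assumes "exp 1 \<le> \<theta>" "k \<in> {1, 2}"
  shows "radial_weight (log_weight k \<theta>)"
  using assms by unfold_locales (auto intro!: weight_log_weight log_weight_antimono)

section \<open>Bounded and compact composition operators\<close>

lemma comp_op_hol_disc:
  assumes "\<phi> holomorphic_on unit_disc" "\<phi> ` unit_disc \<subseteq> unit_disc" "f holomorphic_on unit_disc"
  shows "comp_op \<phi> f \<in> hol_disc"
proof -
  have "(f \<circ> \<phi>) holomorphic_on unit_disc"
    using assms by (intro holomorphic_on_compose_gen)
  then have "comp_op \<phi> f holomorphic_on unit_disc"
    by (rule holomorphic_transform) (auto simp: comp_op_def)
  then show ?thesis by (auto simp: hol_disc_def comp_op_def)
qed

lemma deriv_comp_op:
  assumes "\<phi> holomorphic_on unit_disc" "\<phi> ` unit_disc \<subseteq> unit_disc" "f holomorphic_on unit_disc"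
    and z: "z \<in> unit_disc"
  shows "deriv (comp_op \<phi> f) z = deriv f (\<phi> z) * deriv \<phi> z"
proof -
  have "\<forall>\<^sub>F w in nhds z. comp_op \<phi> f w = (f \<circ> \<phi>) w"
    using z by (auto simp: eventually_nhds comp_op_def intro!: exI[of _ unit_disc])
  then have "deriv (comp_op \<phi> f) z = deriv (f \<circ> \<phi>) z" by (intro deriv_cong_ev) auto
  also have "\<dots> = deriv f (\<phi> z) * deriv \<phi> z"
    using assms image_subset_iff[THEN iffD1, OF assms(2), rule_format, OF z]
    by (intro deriv_chain holomorphic_on_imp_differentiable_at[of _ unit_disc]) auto
  finally show ?thesis .
qed

lemma linear_op_comp_op:
  assumes "\<phi> ` unit_disc \<subseteq> unit_disc" "comp_op \<phi> ` bloch_space \<nu> \<subseteq> bloch_space \<mu>"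
  shows "linear_op \<nu> \<mu> (comp_op \<phi>)"
  using assms by (auto simp: linear_op_def comp_op_def)

context radial_weight
begin

text \<open>The derivative of the composition is estimated by the chain rule; the value at the origin is
\<open>f (\<phi> 0)\<close>, which differs from \<open>f 0\<close> by at most the length of the segment times the maximum of
\<open>|f'|\<close> on the disc of radius \<open>|\<phi> 0|\<close>.\<close>

lemma comp_op_norm_le:
  assumes \<phi>: "\<phi> holomorphic_on unit_disc" "\<phi> ` unit_disc \<subseteq> unit_disc"
    and C: "\<And>z. z \<in> unit_disc \<Longrightarrow> \<mu> z * cmod (deriv \<phi> z) \<le> C * \<nu> (\<phi> z)" "0 \<le> C"
    and f: "f \<in> bloch_space \<nu>"
  shows "comp_op \<phi> f \<in> bloch_space \<mu>"
    and "bloch_norm \<mu> (comp_op \<phi> f) \<le> (1 + 1 / \<nu> (\<phi> 0) + C) * bloch_norm \<nu> f"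
proof -
  let ?N = "bloch_norm \<nu> f"
  have d: "\<mu> z * cmod (deriv (comp_op \<phi> f) z) \<le> C * ?N" if z: "z \<in> unit_disc" for z
  proof -
    have w: "\<phi> z \<in> unit_disc" using \<phi>(2) z by blast
    have "\<mu> z * cmod (deriv (comp_op \<phi> f) z) = (\<mu> z * cmod (deriv \<phi> z)) * cmod (deriv f (\<phi> z))"
      using \<phi> f z by (simp add: deriv_comp_op bloch_space_holomorphic norm_mult mult_ac)
    also have "\<dots> \<le> (C * \<nu> (\<phi> z)) * cmod (deriv f (\<phi> z))"
      using C(1)[OF z] by (intro mult_right_mono) auto
    also have "\<dots> = C * (\<nu> (\<phi> z) * cmod (deriv f (\<phi> z)))" by simp
    also have "\<dots> \<le> C * ?N"
      using bloch_normD[OF f w] norm_ge_zero[of "f 0"] C(2)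
      by (intro mult_left_mono) (simp_all del: norm_ge_zero)
    finally show ?thesis .
  qed
  show "comp_op \<phi> f \<in> bloch_space \<mu>"
    using bloch_spaceI[OF comp_op_hol_disc[OF \<phi> bloch_space_holomorphic[OF f]] d] .
  have 1: "\<phi> 0 \<in> unit_disc" using \<phi>(2) by force
  have "cmod (f (\<phi> 0) - f 0) \<le> ?N / \<nu> (of_real (cmod (\<phi> 0))) * cmod (\<phi> 0 - 0)"
    using 1 by (intro lipschitz_cball[OF f]) auto
  also have "\<dots> \<le> ?N / \<nu> (of_real (cmod (\<phi> 0))) * 1"
    using 1 pos[of "of_real (cmod (\<phi> 0))"] bloch_norm_nonneg[of \<nu> f] by (intro mult_left_mono) auto
  also have "\<nu> (of_real (cmod (\<phi> 0))) = \<nu> (\<phi> 0)"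
    using 1 by (intro antisym antimono) auto
  finally have "cmod (f (\<phi> 0)) \<le> cmod (f 0) + ?N / \<nu> (\<phi> 0)"
    using norm_triangle_ineq2[of "f (\<phi> 0)" "f 0"] by simp
  moreover have "cmod (f 0) \<le> ?N" by (simp add: bloch_norm_def)
  ultimately have "cmod (comp_op \<phi> f 0) \<le> ?N + ?N / \<nu> (\<phi> 0)" by (simp add: comp_op_def)
  then have "bloch_norm \<mu> (comp_op \<phi> f) \<le> (?N + ?N / \<nu> (\<phi> 0)) + C * ?N"
    using d C(2) bloch_norm_nonneg[of \<nu> f] by (intro bloch_norm_le) auto
  then show "bloch_norm \<mu> (comp_op \<phi> f) \<le> (1 + 1 / \<nu> (\<phi> 0) + C) * ?N"
    by (simp add: algebra_simps)
qed

lemma comp_op_bounded: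
  assumes \<phi>: "\<phi> holomorphic_on unit_disc" "\<phi> ` unit_disc \<subseteq> unit_disc"
    and C: "\<And>z. z \<in> unit_disc \<Longrightarrow> \<mu> z * cmod (deriv \<phi> z) \<le> C * \<nu> (\<phi> z)" "0 \<le> C"
  shows "bounded_op \<nu> \<mu> (comp_op \<phi>)"
  unfolding bounded_op_def using comp_op_norm_le[OF assms] linear_op_comp_op[OF \<phi>(2)] by blast

text \<open>Norm bounds give local uniform bounds, so Montel's theorem applies; Cauchy's estimate on a slightly
larger disc upgrades the convergence to derivatives. The limit remains in the unit ball because
\<open>|f 0| + \<nu> z |f' z| \<le> 1\<close> is preserved by pointwise limits.\<close>

lemma unit_ball_montel:
  assumes "range F \<subseteq> unit_ball \<nu>"
  obtains g r where "g \<in> unit_ball \<nu>" "strict_mono (r :: nat \<Rightarrow> nat)"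
    "\<And>s. s < 1 \<Longrightarrow> uniform_limit (cball 0 s) (F \<circ> r) g sequentially"
    "\<And>s. s < 1 \<Longrightarrow> uniform_limit (cball 0 s) (\<lambda>n. deriv (F (r n))) (deriv g) sequentially"
proof -
  have mem: "F n \<in> bloch_space \<nu>" "bloch_norm \<nu> (F n) \<le> 1" for n
    using assms by (auto simp: unit_ball_def)
  obtain g r where g: "g holomorphic_on unit_disc" "strict_mono (r :: nat \<Rightarrow> nat)"
    and lim: "\<And>z. z \<in> unit_disc \<Longrightarrow> (\<lambda>n. F (r n) z) \<longlonglongrightarrow> g z"
    and unif: "\<And>K. \<lbrakk>compact K; K \<subseteq> unit_disc\<rbrakk> \<Longrightarrow> uniform_limit K (F \<circ> r) g sequentially"
  proof (rule Montel[of unit_disc "unit_ball \<nu>" F])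
    show "h holomorphic_on unit_disc" if "h \<in> unit_ball \<nu>" for h
      using that by (auto simp: unit_ball_def bloch_space_holomorphic)
    fix K :: "complex set" assume K: "compact K" "K \<subseteq> unit_disc"
    obtain s where s: "s < 1" "0 \<le> s" "K \<subseteq> cball 0 s"
    proof (cases "K = {}")
      case False
      then obtain w where w: "w \<in> K" "\<And>z. z \<in> K \<Longrightarrow> cmod z \<le> cmod w"
        using continuous_attains_sup[OF K(1) False, of cmod] by (auto intro: continuous_intros)
      moreover have "K \<subseteq> cball 0 (cmod w)" using w(2) by auto
      moreover have "cmod w < 1" using w(1) K(2) by auto
      ultimately show thesis using that[of "cmod w"] by simp
    qed (use that[of 0] in auto)
    have "cmod (h z) \<le> 1 + 1 / \<nu> (of_real s)" if h: "h \<in> unit_ball \<nu>" and z: "z \<in> K" for h z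
    proof -
      have N: "h \<in> bloch_space \<nu>" "bloch_norm \<nu> h \<le> 1" using h by (auto simp: unit_ball_def)
      have zs: "cmod z \<le> s" using s z by auto
      have p: "0 < \<nu> (of_real s)" using s by (intro pos) auto
      have "cmod (h z - h 0) \<le> bloch_norm \<nu> h / \<nu> (of_real s) * cmod (z - 0)"
        using zs s by (intro lipschitz_cball[OF N(1)]) auto
      also have "\<dots> \<le> 1 / \<nu> (of_real s) * 1"
        using N p zs s bloch_norm_nonneg[of \<nu> h] by (intro mult_mono divide_right_mono) auto
      finally have "cmod (h z) \<le> cmod (h 0) + 1 / \<nu> (of_real s)"
        using norm_triangle_ineq2[of "h z" "h 0"] by simp
      moreover have "cmod (h 0) \<le> 1"
        using N(2) enn2real_nonneg[of "bloch_seminorm \<nu> h"] unfolding bloch_norm_def by linarith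
      ultimately show ?thesis by simp
    qed
    then show "\<exists>B. \<forall>h\<in>unit_ball \<nu>. \<forall>z\<in>K. cmod (h z) \<le> B" by blast
  qed (use assms in auto)
  define G where "G = (\<lambda>z. if z \<in> unit_disc then g z else 0)"
  have G: "G \<in> hol_disc"
    using holomorphic_transform[OF g(1), of G] by (auto simp: hol_disc_def G_def)
  have sub: "cball 0 s \<subseteq> unit_disc" if "s < 1" for s :: real
    using that by auto
  have U: "uniform_limit (cball 0 s) (F \<circ> r) G sequentially" if s: "s < 1" for s
    using unif[OF compact_cball sub[OF s]]
    by (rule uniform_limit_cong'[THEN iffD1, rotated -1]) (use s in \<open>auto simp: G_def\<close>)
  have V: "uniform_limit (cball 0 s) (\<lambda>n. deriv (F (r n))) (deriv G) sequentially" if s: "s < 1" for s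
  proof (rule uniform_limitI)
    fix \<epsilon> :: real assume \<epsilon>: "\<epsilon> > 0"
    define s' where "s' = (s + 1) / 2"
    have s': "s < s'" "s' < 1" using s by (auto simp: s'_def)
    let ?\<delta> = "\<epsilon> / 2 * (s' - s)"
    have "\<forall>\<^sub>F n in sequentially. \<forall>z\<in>cball 0 s'. dist ((F \<circ> r) n z) (G z) < ?\<delta>"
      using \<epsilon> s' by (intro uniform_limitD[OF U[OF s'(2)]]) auto
    then show "\<forall>\<^sub>F n in sequentially. \<forall>z\<in>cball 0 s. dist (deriv (F (r n)) z) (deriv G z) < \<epsilon>"
    proof eventually_elim
      case (elim n)
      show ?case
      proof
        fix z :: complex assume z: "z \<in> cball 0 s"
        let ?h = "\<lambda>z. 1 * F (r n) z + (-1) * G z"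
        have hol: "F (r n) holomorphic_on unit_disc" "G holomorphic_on unit_disc"
          using bloch_space_holomorphic[OF mem(1)] G by (auto simp: hol_disc_def)
        have "cmod (deriv ?h z) \<le> ?\<delta> / (s' - s)"
        proof (rule deriv_bound_of_bound)
          show "?h holomorphic_on unit_disc" by (intro holomorphic_intros hol)
          show "cmod (?h w) \<le> ?\<delta>" if "cmod w \<le> s'" for w
            using bspec[OF elim, of w] that by (simp add: dist_norm)
        qed (use s' z in auto)
        moreover have "deriv ?h z = 1 * deriv (F (r n)) z + (-1) * deriv G z"
          using z s by (intro deriv_lincomb hol) auto
        moreover have "?\<delta> / (s' - s) = \<epsilon> / 2" using s' by (simp add: field_simps)
        ultimately show "dist (deriv (F (r n)) z) (deriv G z) < \<epsilon>"
          unfolding dist_norm using \<epsilon> by simp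
      qed
    qed
  qed
  have le1: "cmod (G 0) + \<nu> z * cmod (deriv G z) \<le> 1" if z: "z \<in> unit_disc" for z
  proof (rule LIMSEQ_le_const2)
    have "(\<lambda>n. deriv (F (r n)) z) \<longlonglongrightarrow> deriv G z"
      using V[of "cmod z"] z by (intro tendsto_uniform_limitI) auto
    moreover have "(\<lambda>n. F (r n) 0) \<longlonglongrightarrow> G 0" using lim[of 0] by (simp add: G_def)
    ultimately show "(\<lambda>n. cmod (F (r n) 0) + \<nu> z * cmod (deriv (F (r n)) z))
        \<longlonglongrightarrow> cmod (G 0) + \<nu> z * cmod (deriv G z)"
      by (intro tendsto_intros)
    show "\<exists>N. \<forall>n\<ge>N. cmod (F (r n) 0) + \<nu> z * cmod (deriv (F (r n)) z) \<le> 1"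
      using bloch_normD[OF mem(1) z] mem(2) order_trans by blast
  qed
  have *: "\<nu> z * cmod (deriv G z) \<le> 1 - cmod (G 0)" if "z \<in> unit_disc" for z
    using le1[OF that] by simp
  have "cmod (G 0) \<le> 1" using le1[of 0] pos[of 0] by (smt (verit) centre_in_ball mult_nonneg_nonneg norm_ge_zero norm_zero)
  then have "bloch_norm \<nu> G \<le> cmod (G 0) + (1 - cmod (G 0))"
    using * by (intro bloch_norm_le) auto
  then have "G \<in> unit_ball \<nu>" using bloch_spaceI[OF G *] by (simp add: unit_ball_def)
  then show thesis using that[of G r] g U V by blast
qed

text \<open>Take a subsequence converging locally uniformly, and let \<open>h\<close> be the difference from the limit. Where
\<open>|\<phi> z| > s\<close> the smallness assumption beats the bound 2 for the norm of \<open>h\<close>; where \<open>|\<phi> z| \<le> s\<close>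
the values \<open>h' (\<phi> z)\<close> are uniformly small. Since the limit again lies in the unit ball, the image of
the unit ball is itself compact, hence closed.\<close>

lemma comp_op_compact:
  assumes \<mu>: "weight \<mu>"
    and \<phi>: "\<phi> holomorphic_on unit_disc" "\<phi> ` unit_disc \<subseteq> unit_disc"
    and C: "\<And>z. z \<in> unit_disc \<Longrightarrow> \<mu> z * cmod (deriv \<phi> z) \<le> C * \<nu> (\<phi> z)" "0 \<le> C"
    and small: "\<And>\<epsilon>. 0 < \<epsilon> \<Longrightarrow>
      \<exists>s<1. \<forall>z\<in>unit_disc. s < cmod (\<phi> z) \<longrightarrow> \<mu> z * cmod (deriv \<phi> z) \<le> \<epsilon> * \<nu> (\<phi> z)"
  shows "compact_op \<nu> \<mu> (comp_op \<phi>)"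
proof -
  interpret M: Metric_space "bloch_space \<mu>" "bloch_dist \<mu>" by (rule Metric_space_bloch[OF \<mu>])
  let ?T = "comp_op \<phi>"
  have maps: "?T f \<in> bloch_space \<mu>" if "f \<in> bloch_space \<nu>" for f
    using comp_op_norm_le(1)[OF \<phi> C that] .
  have "compactin M.mtopology (?T ` unit_ball \<nu>)"
    unfolding M.compactin_sequentially
  proof (intro conjI allI impI)
    show "?T ` unit_ball \<nu> \<subseteq> bloch_space \<mu>" using maps by (auto simp: unit_ball_def)
    fix \<sigma> :: "nat \<Rightarrow> complex \<Rightarrow> complex" assume "range \<sigma> \<subseteq> ?T ` unit_ball \<nu>"
    then have "\<forall>n. \<exists>f. f \<in> unit_ball \<nu> \<and> \<sigma> n = ?T f" by blast
    then obtain F where F: "\<And>n. F n \<in> unit_ball \<nu>" "\<And>n. \<sigma> n = ?T (F n)" by metis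
    have "range F \<subseteq> unit_ball \<nu>" using F(1) by blast
    then obtain g r where g: "g \<in> unit_ball \<nu>" and r: "strict_mono (r :: nat \<Rightarrow> nat)"
      and U: "\<And>s. s < 1 \<Longrightarrow> uniform_limit (cball 0 s) (F \<circ> r) g sequentially"
      and V: "\<And>s. s < 1 \<Longrightarrow> uniform_limit (cball 0 s) (\<lambda>n. deriv (F (r n))) (deriv g) sequentially"
      by (rule unit_ball_montel) blast
    have gB: "g \<in> bloch_space \<nu>" "bloch_norm \<nu> g \<le> 1" using g by (auto simp: unit_ball_def)
    have FB: "F n \<in> bloch_space \<nu>" "bloch_norm \<nu> (F n) \<le> 1" for n using F(1)[of n] by (auto simp: unit_ball_def)
    have "limitin M.mtopology (\<sigma> \<circ> r) (?T g) sequentially"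
      unfolding M.limitin_metric
    proof (intro conjI allI impI)
      show "?T g \<in> bloch_space \<mu>" using maps gB by blast
      fix \<epsilon> :: real assume \<epsilon>: "\<epsilon> > 0"
      define \<delta> where "\<delta> = \<epsilon> / 4"
      have \<delta>: "\<delta> > 0" using \<epsilon> by (simp add: \<delta>_def)
      obtain s where s: "s < 1" "\<And>z. z \<in> unit_disc \<Longrightarrow> s < cmod (\<phi> z) \<Longrightarrow>
          \<mu> z * cmod (deriv \<phi> z) \<le> \<delta> * \<nu> (\<phi> z)"
        using small[OF \<delta>] by blast
      have p0: "0 < \<nu> 0" by (intro pos) simp
      have \<phi>0: "cmod (\<phi> 0) < 1" using \<phi>(2) by force
      \<comment> \<open>On the part where \<open>|\<phi> z| \<le> s\<close> the factor \<open>\<mu> |\<phi>'|\<close> is at most \<open>C \<nu> 0\<close>;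
        the \<open>+ 1\<close> avoids a division by zero.\<close>
      define \<eta> where "\<eta> = \<delta> / ((C + 1) * \<nu> 0)"
      have \<eta>: "\<eta> > 0" using \<delta> C p0 by (simp add: \<eta>_def)
      have "\<forall>\<^sub>F n in sequentially. \<forall>z\<in>cball 0 s. dist (deriv (F (r n)) z) (deriv g z) < \<eta>"
        using uniform_limitD[OF V[OF s(1)] \<eta>] .
      moreover have "\<forall>\<^sub>F n in sequentially. \<forall>z\<in>cball 0 (cmod (\<phi> 0)). dist ((F \<circ> r) n z) (g z) < \<delta>"
        using uniform_limitD[OF U[OF \<phi>0] \<delta>] .
      ultimately show "\<forall>\<^sub>F n in sequentially. (\<sigma> \<circ> r) n \<in> bloch_space \<mu> \<and> bloch_dist \<mu> ((\<sigma> \<circ> r) n) (?T g) < \<epsilon>"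
      proof eventually_elim
        case (elim n)
        let ?f = "F (r n)"
        let ?h = "\<lambda>z. 1 * ?f z + (-1) * g z"
        have h: "?h \<in> bloch_space \<nu>" "bloch_norm \<nu> ?h \<le> 2"
          using bloch_lincomb[OF weight FB(1) gB(1), of 1 "r n" "-1"] FB(2)[of "r n"] gB(2) by auto
        have dh: "deriv ?h w = deriv ?f w - deriv g w" if "w \<in> unit_disc" for w
          using deriv_lincomb[OF FB(1)[THEN bloch_space_holomorphic] gB(1)[THEN bloch_space_holomorphic] that, of 1 "r n" "-1"]
          by simp
        have "\<mu> z * cmod (deriv (?T ?h) z) \<le> 2 * \<delta>" if z: "z \<in> unit_disc" for z
        proof -
          have w: "\<phi> z \<in> unit_disc" using \<phi>(2) z by blast
          have eq: "\<mu> z * cmod (deriv (?T ?h) z) = (\<mu> z * cmod (deriv \<phi> z)) * cmod (deriv ?h (\<phi> z))"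
            using deriv_comp_op[OF \<phi> bloch_space_holomorphic[OF h(1)] z] by (simp add: norm_mult mult_ac)
          show ?thesis
          proof (cases "s < cmod (\<phi> z)")
            case True
            have "(\<mu> z * cmod (deriv \<phi> z)) * cmod (deriv ?h (\<phi> z))
                \<le> (\<delta> * \<nu> (\<phi> z)) * cmod (deriv ?h (\<phi> z))"
              using s(2)[OF z True] by (intro mult_right_mono) auto
            also have "\<dots> = \<delta> * (\<nu> (\<phi> z) * cmod (deriv ?h (\<phi> z)))" by simp
            also have "\<nu> (\<phi> z) * cmod (deriv ?h (\<phi> z)) \<le> 2"
              using bloch_normD[OF h(1) w] h(2) norm_ge_zero[of "?h 0"] by linarith
            finally show ?thesis using \<delta> unfolding eq by simp
          next
            case False
            then have "cmod (deriv ?h (\<phi> z)) \<le> \<eta>"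
              using elim(1) dh[OF w] by (auto simp: dist_norm intro: less_imp_le)
            moreover have "\<mu> z * cmod (deriv \<phi> z) \<le> C * \<nu> 0"
              using C(1)[OF z] antimono[of 0 "\<phi> z"] w C(2) mult_left_mono[of "\<nu> (\<phi> z)" "\<nu> 0" C] by force
            ultimately have "(\<mu> z * cmod (deriv \<phi> z)) * cmod (deriv ?h (\<phi> z)) \<le> (C * \<nu> 0) * \<eta>"
              using C(2) p0 by - (rule mult_mono, auto)
            also have "\<dots> \<le> ((C + 1) * \<nu> 0) * \<eta>"
              using p0 \<eta> by (intro mult_right_mono) auto
            also have "\<dots> = \<delta>" using p0 C(2) by (simp add: \<eta>_def)
            finally show ?thesis using \<delta> unfolding eq by simp
          qed
        qed
        moreover have "cmod (?T ?h 0) \<le> \<delta>"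
          using elim(2) by (auto simp: comp_op_def dist_norm intro: less_imp_le)
        ultimately have "bloch_norm \<mu> (?T ?h) \<le> \<delta> + 2 * \<delta>"
          using \<delta> by (intro bloch_norm_le) auto
        also have "?T ?h = (\<lambda>z. (\<sigma> \<circ> r) n z - ?T g z)" by (auto simp: comp_op_def F(2))
        finally have "bloch_dist \<mu> ((\<sigma> \<circ> r) n) (?T g) \<le> 3 * \<delta>" by (simp add: bloch_dist_def)
        then show ?case using \<delta> maps[OF FB(1)] F(2) by (simp add: \<delta>_def)
      qed
    qed
    then show "\<exists>l r. l \<in> ?T ` unit_ball \<nu> \<and> strict_mono r \<and> limitin M.mtopology (\<sigma> \<circ> r) l sequentially"
      using g r by blast
  qed
  moreover from this have "M.mtopology closure_of (?T ` unit_ball \<nu>) = ?T ` unit_ball \<nu>"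
    using compactin_imp_closedin[OF M.Hausdorff_space_mtopology] closure_of_closedin by blast
  moreover have "linear_op \<nu> \<mu> ?T" using maps by (intro linear_op_comp_op[OF \<phi>(2)]) blast
  ultimately show ?thesis by (simp add: compact_op_def bloch_topology_def)
qed

end

section \<open>The essential norm from above\<close>

context radial_weight
begin

text \<open>The compact operators used for comparison are the composition operators with symbols \<open>r \<phi>\<close> for
\<open>r < 1\<close>. They satisfy the hypotheses of \<open>comp_op_compact\<close> because no value of \<open>r \<phi>\<close> has modulus
above \<open>r\<close>. As \<open>r\<close> tends to 1, the difference \<open>f' w - r f' (r w)\<close> tends to 0 uniformly for \<open>f\<close> in
the unit ball and \<open>|w| \<le> s\<close>; for \<open>|w| > s\<close> it is at most \<open>2 / \<nu> w\<close>, whence the factor 2.\<close>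

lemma ess_norm_comp_op_le:
  assumes \<mu>: "weight \<mu>"
    and \<phi>: "\<phi> holomorphic_on unit_disc" "\<phi> ` unit_disc \<subseteq> unit_disc"
    and C: "\<And>z. z \<in> unit_disc \<Longrightarrow> \<mu> z * cmod (deriv \<phi> z) \<le> C * \<nu> (\<phi> z)" "0 \<le> C"
    and s: "s < 1" "\<And>z. z \<in> unit_disc \<Longrightarrow> s < cmod (\<phi> z) \<Longrightarrow> \<mu> z * cmod (deriv \<phi> z) \<le> c * \<nu> (\<phi> z)"
    and c: "0 \<le> c"
  shows "ess_norm \<nu> \<mu> (comp_op \<phi>) \<le> ennreal (2 * c)"
proof (rule ennreal_le_epsilon)
  fix \<epsilon> :: real assume \<epsilon>: "0 < \<epsilon>"
  define s0 where "s0 = max s 0"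
  define s1 where "s1 = (1 + s0) / 2"
  have s01: "0 \<le> s0" "s \<le> s0" "s0 < 1" "s0 < s1" "s1 < 1" using s(1) by (auto simp: s0_def s1_def)
  define B where "B = 1 / \<nu> (of_real s1)"
  define D where "D = B / (s1 - s0)"
  have BD: "0 < B" "0 < D" using pos[of "of_real s1"] s01 by (auto simp: B_def D_def)
  have p0: "0 < \<nu> 0" by (intro pos) simp
  have \<phi>0: "cmod (\<phi> 0) < 1" using \<phi>(2) by force
  \<comment> \<open>\<open>B\<close> and \<open>D\<close> bound \<open>f'\<close> and \<open>f''\<close> for \<open>|w| \<le> s0\<close>, and \<open>t Q\<close> is the error
    of replacing \<open>\<phi>\<close> by \<open>(1 - t) \<phi>\<close>, at the origin and where \<open>|\<phi> z| \<le> s0\<close>.\<close>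
  define Q where "Q = C * \<nu> 0 * (D + B) + 1 / \<nu> (\<phi> 0)"
  have Q: "0 \<le> Q" using BD C(2) p0 pos[OF \<phi>0] by (simp add: Q_def)
  define t where "t = min (1 / 2) (\<epsilon> / (Q + 1))"
  have t: "0 < t" "t < 1" using Q \<epsilon> by (auto simp: t_def)
  have tQ: "t * Q \<le> \<epsilon>"
  proof -
    have "t * Q \<le> \<epsilon> / (Q + 1) * (Q + 1)" using Q \<epsilon> t by (intro mult_mono) (auto simp: t_def)
    then show ?thesis using Q by simp
  qed
  define \<psi> where "\<psi> = (\<lambda>z. of_real (1 - t) * \<phi> z)"
  have cm: "cmod (\<psi> z) = (1 - t) * cmod (\<phi> z)" for z
    using t by (simp add: \<psi>_def norm_mult del: of_real_diff)
  have \<psi>le: "cmod (\<psi> z) \<le> cmod (\<phi> z)" for z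
    using t mult_right_mono[of "1 - t" 1 "cmod (\<phi> z)"] by (simp add: cm)
  have in1: "\<phi> z \<in> unit_disc" if "z \<in> unit_disc" for z using that \<phi>(2) by blast
  have \<psi>: "\<psi> holomorphic_on unit_disc" "\<psi> ` unit_disc \<subseteq> unit_disc"
    using in1 le_less_trans[OF \<psi>le] by (auto simp: \<psi>_def intro!: holomorphic_intros \<phi>)
  have d\<psi>: "deriv \<psi> z = of_real (1 - t) * deriv \<phi> z" if "z \<in> unit_disc" for z
    using that \<phi>(1) unfolding \<psi>_def
    by (intro deriv_cmult holomorphic_on_imp_differentiable_at[of _ unit_disc]) auto
  have C\<psi>: "\<mu> z * cmod (deriv \<psi> z) \<le> C * \<nu> (\<psi> z)" if z: "z \<in> unit_disc" for z
  proof -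
    have "0 < \<mu> z" using \<mu> z by (simp add: weight_def)
    then have "\<mu> z * cmod (deriv \<psi> z) \<le> \<mu> z * cmod (deriv \<phi> z)"
      using t mult_right_mono[of "1 - t" 1 "cmod (deriv \<phi> z)"] d\<psi>[OF z]
      by (intro mult_left_mono) (simp_all add: norm_mult del: of_real_diff)
    also have "\<dots> \<le> C * \<nu> (\<phi> z)" by (rule C(1)[OF z])
    also have "\<dots> \<le> C * \<nu> (\<psi> z)" using C(2) in1[OF z] \<psi>le by (intro mult_left_mono antimono) auto
    finally show ?thesis .
  qed
  have "compact_op \<nu> \<mu> (comp_op \<psi>)"
  proof (rule comp_op_compact[OF \<mu> \<psi> C\<psi> C(2)])
    have "\<not> 1 - t < cmod (\<psi> z)" if "z \<in> unit_disc" for z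
      using in1[OF that] t mult_left_mono[of "cmod (\<phi> z)" 1 "1 - t"] by (auto simp: cm)
    then show "\<exists>s<1. \<forall>z\<in>unit_disc. s < cmod (\<psi> z) \<longrightarrow> \<mu> z * cmod (deriv \<psi> z) \<le> \<epsilon>' * \<nu> (\<psi> z)" for \<epsilon>'
      using t by (intro exI[of _ "1 - t"]) auto
  qed
  then have "ess_norm \<nu> \<mu> (comp_op \<phi>) \<le> op_norm \<nu> \<mu> (\<lambda>f z. comp_op \<phi> f z - comp_op \<psi> f z)"
    unfolding ess_norm_def by (intro INF_lower) auto
  also have "\<dots> \<le> ennreal (2 * c + \<epsilon>)"
    unfolding op_norm_def
  proof (rule SUP_least, rule ennreal_leI)
    fix f assume "f \<in> unit_ball \<nu>"
    then have f: "f \<in> bloch_space \<nu>" "bloch_norm \<nu> f \<le> 1" by (auto simp: unit_ball_def)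
    note hf = bloch_space_holomorphic[OF f(1)]
    have le1: "\<nu> w * cmod (deriv f w) \<le> 1" if "w \<in> unit_disc" for w
      using bloch_normD[OF f(1) that] f(2) norm_ge_zero[of "f 0"] by linarith
    have leB: "cmod (deriv f w) \<le> B" if "cmod w \<le> s1" for w
    proof -
      have "cmod (deriv f w) \<le> bloch_norm \<nu> f / \<nu> (of_real s1)"
        using that s01 by (intro deriv_bound[OF f(1)]) auto
      also have "\<dots> \<le> B" unfolding B_def
        using f(2) pos[of "of_real s1"] s01 by (intro divide_right_mono) auto
      finally show ?thesis .
    qed
    let ?D = "\<lambda>z. comp_op \<phi> f z - comp_op \<psi> f z"
    have dD: "deriv ?D z = (deriv f (\<phi> z) - of_real (1 - t) * deriv f (\<psi> z)) * deriv \<phi> z"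
      if z: "z \<in> unit_disc" for z
      using deriv_lincomb[OF _ _ z, of "comp_op \<phi> f" "comp_op \<psi> f" 1 "-1"]
        comp_op_hol_disc[OF \<phi> hf] comp_op_hol_disc[OF \<psi> hf]
        deriv_comp_op[OF \<phi> hf z] deriv_comp_op[OF \<psi> hf z] d\<psi>[OF z]
      by (simp add: hol_disc_def algebra_simps del: of_real_diff)
    have "\<mu> z * cmod (deriv ?D z) \<le> t * (C * \<nu> 0 * (D + B)) + 2 * c" if z: "z \<in> unit_disc" for z
    proof -
      let ?a = "deriv f (\<phi> z)" and ?b = "deriv f (\<psi> z)"
      have w: "\<phi> z \<in> unit_disc" "\<psi> z \<in> unit_disc" using z \<phi>(2) \<psi>(2) by blast+
      have eq: "\<mu> z * cmod (deriv ?D z) = (\<mu> z * cmod (deriv \<phi> z)) * cmod (?a - of_real (1 - t) * ?b)"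
        by (simp add: dD[OF z] norm_mult mult_ac del: of_real_diff)
      have nb: "cmod (of_real (1 - t) * ?b) = (1 - t) * cmod ?b"
        using t by (simp add: norm_mult del: of_real_diff)
      show ?thesis
      proof (cases "s0 < cmod (\<phi> z)")
        case True
        have "cmod (?a - of_real (1 - t) * ?b) \<le> cmod ?a + (1 - t) * cmod ?b"
          using norm_triangle_ineq4[of ?a "of_real (1 - t) * ?b"] by (simp only: nb)
        also have "\<dots> \<le> cmod ?a + 1 * cmod ?b"
          using t by (intro add_left_mono mult_right_mono) auto
        finally have "(\<mu> z * cmod (deriv \<phi> z)) * cmod (?a - of_real (1 - t) * ?b)
            \<le> (c * \<nu> (\<phi> z)) * (cmod ?a + cmod ?b)"
          using True s01 s(2)[OF z] c pos w by - (rule mult_mono, auto simp: less_imp_le)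
        also have "\<dots> = c * (\<nu> (\<phi> z) * cmod ?a + \<nu> (\<phi> z) * cmod ?b)" by (simp add: algebra_simps)
        also have "\<dots> \<le> c * (\<nu> (\<phi> z) * cmod ?a + \<nu> (\<psi> z) * cmod ?b)"
          using c w \<psi>le by (intro mult_left_mono add_left_mono mult_right_mono antimono) auto
        also have "\<dots> \<le> c * (1 + 1)"
          using c le1 w by (intro mult_left_mono add_mono) auto
        also have "\<dots> \<le> t * (C * \<nu> 0 * (D + B)) + 2 * c"
          using t C(2) p0 BD by simp
        finally show ?thesis by (simp only: eq)
      next
        case False
        then have ws: "cmod (\<phi> z) \<le> s0" "cmod (\<psi> z) \<le> s0"
          using \<psi>le[of z] by auto
        have "cmod (?a - ?b) \<le> D * cmod (\<phi> z - \<psi> z)"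
        proof (rule holomorphic_lipschitz_cball[of "deriv f" s0])
          show "deriv f holomorphic_on unit_disc" using hf by (intro holomorphic_deriv) auto
          then show "cmod (deriv (deriv f) x) \<le> D" if "cmod x \<le> s0" for x
            unfolding D_def using leB s01 that by (intro deriv_bound_of_bound)
        qed (use s01 ws in auto)
        also have "\<phi> z - \<psi> z = of_real t * \<phi> z" by (simp add: \<psi>_def algebra_simps)
        also have "D * cmod (of_real t * \<phi> z) \<le> D * (t * 1)"
          using BD t w by (intro mult_left_mono) (auto simp: norm_mult intro!: mult_left_le)
        finally have 1: "cmod (?a - ?b) \<le> t * D" by (simp add: mult.commute)
        have 2: "cmod (of_real t * ?b) \<le> t * B"
          using leB[of "\<psi> z"] ws s01 t by (auto simp: norm_mult intro!: mult_left_mono)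
        have "?a - of_real (1 - t) * ?b = (?a - ?b) + of_real t * ?b" by (simp add: algebra_simps)
        then have "cmod (?a - of_real (1 - t) * ?b) \<le> t * (D + B)"
          using norm_triangle_ineq[of "?a - ?b" "of_real t * ?b"] 1 2
          by (simp only: distrib_left)
        moreover have "\<mu> z * cmod (deriv \<phi> z) \<le> C * \<nu> 0"
          using C(1)[OF z] antimono[of 0 "\<phi> z"] w C(2) mult_left_mono[of "\<nu> (\<phi> z)" "\<nu> 0" C] by force
        ultimately have "(\<mu> z * cmod (deriv \<phi> z)) * cmod (?a - of_real (1 - t) * ?b) \<le> (C * \<nu> 0) * (t * (D + B))"
          using C(2) p0 by - (rule mult_mono, auto)
        also have "\<dots> \<le> t * (C * \<nu> 0 * (D + B)) + 2 * c" using c by (simp add: mult_ac)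
        finally show ?thesis by (simp only: eq)
      qed
    qed
    moreover have "cmod (?D 0) \<le> t * (1 / \<nu> (\<phi> 0))"
    proof -
      have "cmod (f (\<phi> 0) - f (\<psi> 0)) \<le> bloch_norm \<nu> f / \<nu> (of_real (cmod (\<phi> 0))) * cmod (\<phi> 0 - \<psi> 0)"
        using \<phi>0 \<psi>le by (intro lipschitz_cball[OF f(1)]) auto
      also have "\<nu> (of_real (cmod (\<phi> 0))) = \<nu> (\<phi> 0)"
        using \<phi>0 by (intro antisym antimono) auto
      also have "\<phi> 0 - \<psi> 0 = of_real t * \<phi> 0" by (simp add: \<psi>_def algebra_simps)
      also have "bloch_norm \<nu> f / \<nu> (\<phi> 0) * cmod (of_real t * \<phi> 0) \<le> 1 / \<nu> (\<phi> 0) * (t * 1)"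
        using f(2) \<phi>0 pos[OF \<phi>0] t
        by (intro mult_mono divide_right_mono) (auto simp: norm_mult intro!: mult_left_le)
      finally show ?thesis by (simp add: comp_op_def mult.commute)
    qed
    ultimately have "bloch_norm \<mu> ?D \<le> t * (1 / \<nu> (\<phi> 0)) + (t * (C * \<nu> 0 * (D + B)) + 2 * c)"
      using t c C(2) p0 BD by (intro bloch_norm_le) auto
    also have "\<dots> = t * Q + 2 * c" by (simp add: Q_def algebra_simps)
    also have "\<dots> \<le> 2 * c + \<epsilon>" using tQ by simp
    finally show "bloch_norm \<mu> ?D \<le> 2 * c + \<epsilon>" .
  qed
  also have "\<dots> = ennreal (2 * c) + ennreal \<epsilon>" using c \<epsilon> by (intro ennreal_plus) auto
  finally show "ess_norm \<nu> \<mu> (comp_op \<phi>) \<le> ennreal (2 * c) + ennreal \<epsilon>" .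
qed

end

section \<open>The essential norm from below\<close>

text \<open>The set \<open>J\<close> is built one index at a time. The partial sum is small near the boundary, so there the next
function contributes alone, and away from the boundary the next function is small if its index is large.
Each step therefore raises the bound by an arbitrarily small amount only. The induction carries a bound
strictly below 2, to leave room for the next step, and the smallness of the partial sum at the boundary.\<close>

lemma gliding_hump:
  fixes \<nu> :: "complex \<Rightarrow> real" and e :: "nat \<Rightarrow> complex \<Rightarrow> complex"
  assumes nn: "\<And>z. z \<in> unit_disc \<Longrightarrow> 0 \<le> \<nu> z"
    and one: "\<And>j z. z \<in> unit_disc \<Longrightarrow> \<nu> z * cmod (e j z) \<le> 1"
    and bd: "\<And>j \<epsilon>. 0 < \<epsilon> \<Longrightarrow> \<exists>s<1. \<forall>z\<in>unit_disc. s < cmod z \<longrightarrow> \<nu> z * cmod (e j z) \<le> \<epsilon>"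
    and loc: "\<And>s \<epsilon>. s < 1 \<Longrightarrow> 0 < \<epsilon> \<Longrightarrow> \<forall>\<^sub>F j in sequentially. \<forall>z. cmod z \<le> s \<longrightarrow> \<nu> z * cmod (e j z) \<le> \<epsilon>"
    and A: "infinite A"
  obtains J where "J \<subseteq> A" "finite J" "card J = N"
    "\<And>z. z \<in> unit_disc \<Longrightarrow> \<nu> z * cmod (\<Sum>j\<in>J. e j z) \<le> 2"
proof -
  have "\<exists>J\<subseteq>A. finite J \<and> card J = N \<and>
      (\<exists>b<2. \<forall>z\<in>unit_disc. \<nu> z * cmod (\<Sum>j\<in>J. e j z) \<le> b) \<and>
      (\<forall>\<epsilon>>0. \<exists>s<1. \<forall>z\<in>unit_disc. s < cmod z \<longrightarrow> \<nu> z * cmod (\<Sum>j\<in>J. e j z) \<le> \<epsilon>)"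
  proof (induction N)
    case 0
    show ?case by (intro exI[of _ "{}"]) (auto intro: exI[of _ 0])
  next
    case (Suc N)
    then obtain J b where J: "J \<subseteq> A" "finite J" "card J = N"
      and b: "b < 2" "\<And>z. z \<in> unit_disc \<Longrightarrow> \<nu> z * cmod (\<Sum>j\<in>J. e j z) \<le> b"
      and little: "\<And>\<epsilon>. 0 < \<epsilon> \<Longrightarrow> \<exists>s<1. \<forall>z\<in>unit_disc. s < cmod z \<longrightarrow> \<nu> z * cmod (\<Sum>j\<in>J. e j z) \<le> \<epsilon>"
      by blast
    define \<delta> where "\<delta> = min (1 / 2) ((2 - b) / 2)"
    have \<delta>: "0 < \<delta>" "b + \<delta> < 2" "1 + \<delta> < 2" using b(1) by (auto simp: \<delta>_def min_def field_simps)
    obtain s where s: "s < 1" "\<And>z. z \<in> unit_disc \<Longrightarrow> s < cmod z \<Longrightarrow> \<nu> z * cmod (\<Sum>j\<in>J. e j z) \<le> \<delta>"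
      using little[OF \<delta>(1)] by blast
    obtain n where n: "\<And>j z. n \<le> j \<Longrightarrow> cmod z \<le> s \<Longrightarrow> \<nu> z * cmod (e j z) \<le> \<delta>"
      using loc[OF s(1) \<delta>(1)] by (auto simp: eventually_sequentially)
    obtain j where j: "j \<in> A" "n \<le> j" "j \<notin> J"
    proof -
      have "infinite (A - (J \<union> {..<n}))" using A J(2) by simp
      then obtain j where "j \<in> A - (J \<union> {..<n})" by (metis finite.emptyI all_not_in_conv)
      then show thesis using that[of j] by auto
    qed
    have tri: "\<nu> z * cmod (\<Sum>i\<in>insert j J. e i z) \<le> \<nu> z * cmod (e j z) + \<nu> z * cmod (\<Sum>i\<in>J. e i z)"
      if "z \<in> unit_disc" for z
      using J(2) j(3) mult_left_mono[OF norm_triangle_ineq nn[OF that], of "e j z" "\<Sum>i\<in>J. e i z"]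
      by (simp add: distrib_left)
    have "\<nu> z * cmod (\<Sum>i\<in>insert j J. e i z) \<le> max (b + \<delta>) (1 + \<delta>)" if z: "z \<in> unit_disc" for z
      using tri[OF z] b(2)[OF z] s(2)[OF z] one[OF z, of j] n[OF j(2), of z] by fastforce
    moreover have "\<exists>s<1. \<forall>z\<in>unit_disc. s < cmod z \<longrightarrow> \<nu> z * cmod (\<Sum>i\<in>insert j J. e i z) \<le> \<epsilon>"
      if \<epsilon>: "0 < \<epsilon>" for \<epsilon>
    proof -
      obtain s1 where s1: "s1 < 1" "\<And>z. z \<in> unit_disc \<Longrightarrow> s1 < cmod z \<Longrightarrow> \<nu> z * cmod (\<Sum>j\<in>J. e j z) \<le> \<epsilon> / 2"
        using little[of "\<epsilon> / 2"] \<epsilon> by auto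
      obtain s2 where s2: "s2 < 1" "\<And>z. z \<in> unit_disc \<Longrightarrow> s2 < cmod z \<Longrightarrow> \<nu> z * cmod (e j z) \<le> \<epsilon> / 2"
        using bd[of "\<epsilon> / 2" j] \<epsilon> by auto
      show ?thesis
      proof (intro exI[of _ "max s1 s2"] conjI ballI impI)
        fix z :: complex assume z: "z \<in> unit_disc" "max s1 s2 < cmod z"
        then show "\<nu> z * cmod (\<Sum>i\<in>insert j J. e i z) \<le> \<epsilon>"
          using tri[OF z(1)] s1(2)[OF z(1)] s2(2)[OF z(1)] by simp
      qed (use s1 s2 in auto)
    qed
    moreover have "max (b + \<delta>) (1 + \<delta>) < 2" using \<delta> by simp
    moreover have "insert j J \<subseteq> A" "finite (insert j J)" "card (insert j J) = Suc N" using J j by auto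
    ultimately show ?case by blast
  qed
  then show thesis using that less_imp_le order_trans by metis
qed

lemma bloch_sum:
  assumes "weight \<mu>" "finite J" "\<And>j. j \<in> J \<Longrightarrow> g j \<in> bloch_space \<mu>"
  shows "(\<lambda>z. \<Sum>j\<in>J. g j z) \<in> bloch_space \<mu> \<and>
    bloch_norm \<mu> (\<lambda>z. \<Sum>j\<in>J. g j z) \<le> (\<Sum>j\<in>J. bloch_norm \<mu> (g j))"
  using assms(2,3)
proof (induction J)
  case empty
  show ?case by (auto simp: bloch_space_def hol_disc_def bloch_norm_def bloch_seminorm_def)
next
  case (insert j J)
  then show ?case
    using bloch_lincomb[OF assms(1), of "g j" "\<lambda>z. \<Sum>j\<in>J. g j z" 1 1] by fastforce
qed

lemma linear_opD:
  assumes "linear_op \<nu> \<mu> S" "f \<in> bloch_space \<nu>" "g \<in> bloch_space \<nu>"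
  shows "S (\<lambda>z. a * f z + b * g z) = (\<lambda>z. a * S f z + b * S g z)"
  using assms by (simp add: linear_op_def)

lemma linear_op_sum:
  assumes "weight \<nu>" "linear_op \<nu> \<mu> S" "finite J" "\<And>j. j \<in> J \<Longrightarrow> g j \<in> bloch_space \<nu>"
  shows "S (\<lambda>z. \<Sum>j\<in>J. g j z) = (\<lambda>z. \<Sum>j\<in>J. S (g j) z)"
  using assms(3,4)
proof (induction J)
  case empty
  have "(\<lambda>z. 0) \<in> bloch_space \<nu>"
    by (simp add: bloch_space_def hol_disc_def bloch_seminorm_def)
  from linear_opD[OF assms(2) this this, of 0 0] show ?case by simp
next
  case (insert j J)
  have "g j \<in> bloch_space \<nu>" "(\<lambda>z. \<Sum>j\<in>J. g j z) \<in> bloch_space \<nu>"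
    using insert.prems bloch_sum[OF assms(1) insert.hyps(1), of g] by simp_all
  from linear_opD[OF assms(2) this, of 1 1] show ?case using insert by simp
qed

text \<open>Suppose infinitely many images have norm at least \<open>\<epsilon>\<close>. Total boundedness of the image of the unit ball
yields infinitely many indices whose images lie within \<open>\<epsilon> / 4\<close> of one vector \<open>x\<close>, so
\<open>\<parallel>x\<parallel> \<ge> 3 \<epsilon> / 4\<close>. Choose \<open>N\<close> of these indices by \<open>gliding_hump\<close>, and let \<open>R\<close> bound the image of
the unit ball. The sum \<open>f\<close> of the chosen functions has norm at most 2, so \<open>\<parallel>S f\<parallel> \<le> 2 R\<close>; but
\<open>S f / N\<close> lies within \<open>\<epsilon> / 4\<close> of \<open>x\<close>, which is impossible for large \<open>N\<close>.\<close>

lemma compact_op_null: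
  assumes \<nu>: "weight \<nu>" and \<mu>: "weight \<mu>" and S: "compact_op \<nu> \<mu> S"
    and e: "\<And>j. e j \<in> unit_ball \<nu>" "\<And>j. e j 0 = 0"
    and bd: "\<And>j \<epsilon>. 0 < \<epsilon> \<Longrightarrow> \<exists>s<1. \<forall>z\<in>unit_disc. s < cmod z \<longrightarrow> \<nu> z * cmod (deriv (e j) z) \<le> \<epsilon>"
    and loc: "\<And>s \<epsilon>. s < 1 \<Longrightarrow> 0 < \<epsilon> \<Longrightarrow>
      \<forall>\<^sub>F j in sequentially. \<forall>z. cmod z \<le> s \<longrightarrow> \<nu> z * cmod (deriv (e j) z) \<le> \<epsilon>"
  shows "(\<lambda>j. bloch_norm \<mu> (S (e j))) \<longlonglongrightarrow> 0"
proof (rule ccontr)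
  interpret M: Metric_space "bloch_space \<mu>" "bloch_dist \<mu>" by (rule Metric_space_bloch[OF \<mu>])
  have lin: "linear_op \<nu> \<mu> S" using S by (simp add: compact_op_def)
  have eB: "e j \<in> bloch_space \<nu>" "bloch_norm \<nu> (e j) \<le> 1" for j using e(1)[of j] by (auto simp: unit_ball_def)
  have maps: "S f \<in> bloch_space \<mu>" if "f \<in> bloch_space \<nu>" for f
    using lin that by (auto simp: linear_op_def)
  assume "\<not> (\<lambda>j. bloch_norm \<mu> (S (e j))) \<longlonglongrightarrow> 0"
  then obtain \<epsilon> where \<epsilon>: "0 < \<epsilon>" "\<And>n. \<exists>j\<ge>n. \<epsilon> \<le> bloch_norm \<mu> (S (e j))"
    by (auto simp: LIMSEQ_iff bloch_norm_nonneg not_less)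
  define A0 where "A0 = {j. \<epsilon> \<le> bloch_norm \<mu> (S (e j))}"
  have "infinite A0" unfolding infinite_nat_iff_unbounded_le A0_def using \<epsilon>(2) by auto
  have "S ` unit_ball \<nu> \<subseteq> bloch_space \<mu>" using maps by (auto simp: unit_ball_def)
  then have tb: "M.mtotally_bounded (S ` unit_ball \<nu>)"
    using S M.compact_closure_of_imp_mtotally_bounded by (simp add: compact_op_def bloch_topology_def)
  then obtain K where K: "finite K" "S ` unit_ball \<nu> \<subseteq> (\<Union>x\<in>K. M.mball x (\<epsilon> / 4))"
    using \<epsilon>(1) unfolding M.mtotally_bounded_def by (meson divide_pos_pos zero_less_numeral)
  define R where "R = (\<Sum>x\<in>K. bloch_norm \<mu> x) + \<epsilon> / 4"
  have R: "bloch_norm \<mu> (S f) \<le> R" if f: "f \<in> unit_ball \<nu>" for f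
  proof -
    obtain x where x: "x \<in> K" "S f \<in> M.mball x (\<epsilon> / 4)" using K(2) f by blast
    then have "bloch_norm \<mu> (\<lambda>z. S f z - x z) < \<epsilon> / 4" "S f \<in> bloch_space \<mu>" "x \<in> bloch_space \<mu>"
      using M.commute[of x "S f"] by (auto simp: bloch_dist_def)
    then have "bloch_norm \<mu> (S f) \<le> \<epsilon> / 4 + bloch_norm \<mu> x" using bloch_diff(2)[OF \<mu>] by fastforce
    also have "bloch_norm \<mu> x \<le> (\<Sum>x\<in>K. bloch_norm \<mu> x)"
      using K(1) x(1) by (intro member_le_sum) (auto simp: bloch_norm_nonneg)
    finally show ?thesis by (simp add: R_def)
  qed
  have "\<exists>x\<in>K. infinite {j \<in> A0. S (e j) \<in> M.mball x (\<epsilon> / 4)}"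
  proof (rule pigeonhole_infinite_rel)
    show "\<forall>j\<in>A0. \<exists>x\<in>K. S (e j) \<in> M.mball x (\<epsilon> / 4)" using K(2) e(1) by blast
  qed fact+
  then obtain x where "infinite {j \<in> A0. S (e j) \<in> M.mball x (\<epsilon> / 4)}" by blast
  moreover define A where "A = {j \<in> A0. S (e j) \<in> M.mball x (\<epsilon> / 4)}"
  ultimately have A: "infinite A" by simp
  have near: "x \<in> bloch_space \<mu>" "bloch_norm \<mu> (\<lambda>z. S (e j) z - x z) \<le> \<epsilon> / 4" if "j \<in> A" for j
    using that M.commute[of x "S (e j)"] by (auto simp: A_def bloch_dist_def intro: less_imp_le)
  have x: "x \<in> bloch_space \<mu>" using near(1) A by (metis finite.emptyI all_not_in_conv)
  obtain N where "max (4 * R / \<epsilon>) 0 < real N" using reals_Archimedean2 by blast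
  then have N: "4 * R / \<epsilon> < real N" "0 < N" by simp_all
  obtain J where J: "J \<subseteq> A" "finite J" "card J = N"
    and J2: "\<And>z. z \<in> unit_disc \<Longrightarrow> \<nu> z * cmod (\<Sum>j\<in>J. deriv (e j) z) \<le> 2"
  proof (rule gliding_hump[of \<nu> "\<lambda>j. deriv (e j)" A N])
    show "\<nu> z * cmod (deriv (e j) z) \<le> 1" if "z \<in> unit_disc" for j z
      using bloch_normD[OF eB(1) that, of j] eB(2)[of j] norm_ge_zero[of "e j 0"] by linarith
    show "0 \<le> \<nu> z" if "z \<in> unit_disc" for z using \<nu> that by (auto simp: weight_def less_imp_le)
  qed (use bd loc A in auto)
  define f where "f = (\<lambda>z. \<Sum>j\<in>J. e j z)"
  have f: "f \<in> bloch_space \<nu>" unfolding f_def using bloch_sum[OF \<nu> J(2), of e] eB(1) by blast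
  have "deriv f z = (\<Sum>j\<in>J. deriv (e j) z)" if "z \<in> unit_disc" for z
    unfolding f_def using that
    by (intro deriv_sum holomorphic_on_imp_differentiable_at[OF bloch_space_holomorphic[OF eB(1)]]) auto
  then have "bloch_norm \<nu> f \<le> 0 + 2"
    using J2 e(2) by (intro bloch_norm_le) (auto simp: f_def)
  moreover have "bloch_norm \<nu> (\<lambda>z. (1 / 2) * f z + 0 * f z) \<le> cmod (1 / 2) * bloch_norm \<nu> f + cmod 0 * bloch_norm \<nu> f"
    by (rule bloch_lincomb(2)[OF \<nu> f f])
  ultimately have "(\<lambda>z. (1 / 2) * f z + 0 * f z) \<in> unit_ball \<nu>"
    using bloch_lincomb(1)[OF \<nu> f f, of "1 / 2" 0] by (simp add: unit_ball_def)
  then have "bloch_norm \<mu> (S (\<lambda>z. (1 / 2) * f z + 0 * f z)) \<le> R" by (rule R)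
  also have "S (\<lambda>z. (1 / 2) * f z + 0 * f z) = (\<lambda>z. (1 / 2) * S f z + 0 * S f z)"
    by (rule linear_opD[OF lin f f])
  finally have "bloch_norm \<mu> (\<lambda>z. (1 / 2) * S f z) \<le> R" by simp
  then have Sf: "bloch_norm \<mu> (S f) \<le> 2 * R"
    using bloch_lincomb[OF \<mu> maps[OF f] maps[OF f], of "1 / 2" 0]
      bloch_lincomb(2)[OF \<mu>, of "\<lambda>z. (1 / 2) * S f z" "\<lambda>z. (1 / 2) * S f z" 2 0] by simp
  have Sfe: "S f = (\<lambda>z. \<Sum>j\<in>J. S (e j) z)"
    unfolding f_def using eB(1) by (intro linear_op_sum[OF \<nu> lin J(2)])
  define g where "g = (\<lambda>z. \<Sum>j\<in>J. S (e j) z - x z)"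
  have g: "g \<in> bloch_space \<mu>" "bloch_norm \<mu> g \<le> real N * (\<epsilon> / 4)"
  proof -
    have *: "(\<lambda>z. S (e j) z - x z) \<in> bloch_space \<mu>" for j
      by (rule bloch_diff(1)[OF \<mu> maps[OF eB(1)] x])
    note sum = bloch_sum[OF \<mu> J(2), of "\<lambda>j z. S (e j) z - x z", OF *]
    show "g \<in> bloch_space \<mu>" unfolding g_def using sum by simp
    have "bloch_norm \<mu> g \<le> (\<Sum>j\<in>J. bloch_norm \<mu> (\<lambda>z. S (e j) z - x z))"
      unfolding g_def using sum by simp
    also have "\<dots> \<le> real (card J) * (\<epsilon> / 4)" using near(2) J(1) by (intro sum_bounded_above) auto
    finally show "bloch_norm \<mu> g \<le> real N * (\<epsilon> / 4)" using J(3) by simp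
  qed
  have "x = (\<lambda>z. of_real (1 / N) * S f z + of_real (- 1 / N) * g z)"
    using N(2) J(3) by (auto simp: Sfe g_def sum_subtractf field_simps)
  then have "bloch_norm \<mu> x = bloch_norm \<mu> (\<lambda>z. of_real (1 / N) * S f z + of_real (- 1 / N) * g z)"
    by (rule arg_cong)
  also have "\<dots> \<le> cmod (of_real (1 / N)) * bloch_norm \<mu> (S f) + cmod (of_real (- 1 / N)) * bloch_norm \<mu> g"
    by (rule bloch_lincomb(2)[OF \<mu> maps[OF f] g(1)])
  also have "\<dots> = 1 / N * bloch_norm \<mu> (S f) + 1 / N * bloch_norm \<mu> g"
    by (simp add: norm_divide)
  also have "\<dots> \<le> 1 / N * (2 * R) + 1 / N * (real N * (\<epsilon> / 4))"
    using Sf g(2) by (intro add_mono mult_left_mono) auto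
  also have "\<dots> < \<epsilon> / 2 + \<epsilon> / 4"
    using N \<epsilon>(1) by (simp add: field_simps)
  finally have xl: "bloch_norm \<mu> x < 3 * \<epsilon> / 4" by simp
  obtain j where j: "j \<in> A" using A by (metis finite.emptyI all_not_in_conv)
  have "\<epsilon> \<le> bloch_norm \<mu> (S (e j))" using j by (simp add: A_def A0_def)
  also have "\<dots> \<le> \<epsilon> / 4 + bloch_norm \<mu> x"
    using bloch_diff(2)[OF \<mu> maps[OF eB(1)] x, of j] near(2)[OF j] by linarith
  finally show False using xl by simp
qed

text \<open>For compact \<open>S\<close> the norm of \<open>T - S\<close> is at least \<open>\<parallel>T (e j)\<parallel> - \<parallel>S (e j)\<parallel>\<close>, and the last term
tends to 0.\<close>

lemma limsup_le_ess_norm: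
  assumes \<nu>: "weight \<nu>" and \<mu>: "weight \<mu>" and T: "T ` bloch_space \<nu> \<subseteq> bloch_space \<mu>"
    and e: "\<And>j. e j \<in> unit_ball \<nu>"
    and null: "\<And>S. compact_op \<nu> \<mu> S \<Longrightarrow> (\<lambda>j. bloch_norm \<mu> (S (e j))) \<longlonglongrightarrow> 0"
  shows "limsup (\<lambda>j. bloch_seminorm \<mu> (T (e j))) \<le> ess_norm \<nu> \<mu> T"
  unfolding ess_norm_def
proof (rule INF_greatest)
  fix S assume "S \<in> {S. compact_op \<nu> \<mu> S}"
  then have S: "compact_op \<nu> \<mu> S" by simp
  let ?B = "op_norm \<nu> \<mu> (\<lambda>f z. T f z - S f z)"
  have eB: "e j \<in> bloch_space \<nu>" for j using e[of j] by (auto simp: unit_ball_def)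
  have m: "T (e j) \<in> bloch_space \<mu>" "S (e j) \<in> bloch_space \<mu>" for j
    using T S eB by (auto simp: compact_op_def linear_op_def)
  show "limsup (\<lambda>j. bloch_seminorm \<mu> (T (e j))) \<le> ?B"
  proof (rule ennreal_le_epsilon)
    fix \<epsilon> :: real assume "0 < \<epsilon>"
    then have "\<forall>\<^sub>F j in sequentially. bloch_norm \<mu> (S (e j)) < \<epsilon>"
      by (rule order_tendstoD(2)[OF null[OF S]])
    then show "limsup (\<lambda>j. bloch_seminorm \<mu> (T (e j))) \<le> ?B + ennreal \<epsilon>"
    proof (intro Limsup_bounded, eventually_elim)
      case (elim j)
      have "bloch_seminorm \<mu> (T (e j)) \<le> ennreal (bloch_norm \<mu> (T (e j)))"
        by (rule bloch_seminorm_le_norm[OF m(1)])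
      also have "\<dots> \<le> ennreal (bloch_norm \<mu> (\<lambda>z. T (e j) z - S (e j) z) + bloch_norm \<mu> (S (e j)))"
        by (intro ennreal_leI bloch_diff(2)[OF \<mu> m])
      also have "\<dots> = ennreal (bloch_norm \<mu> (\<lambda>z. T (e j) z - S (e j) z)) + ennreal (bloch_norm \<mu> (S (e j)))"
        by (intro ennreal_plus bloch_norm_nonneg)
      also have "\<dots> \<le> ?B + ennreal \<epsilon>"
        unfolding op_norm_def using elim e by (intro add_mono SUP_upper ennreal_leI) auto
      finally show ?case .
    qed
  qed
qed

section \<open>Monomials and powers of the symbol\<close>

text \<open>The constant of \<open>monomial_profile_upper\<close>, doubled so that it serves the case \<open>k = 2\<close> as well.\<close>

definition monomial_bound :: "real \<Rightarrow> real"
  where "monomial_bound \<theta> = 2 * (2 * exp 1 * ln \<theta> + exp 1 + 2)"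

lemma exp1_ge2: "(2::real) \<le> exp 1"
  using exp_ge_add_one_self[of "1::real"] by simp

lemma monomial_bound_ge1: "exp 1 \<le> \<theta> \<Longrightarrow> 1 \<le> monomial_bound \<theta>"
  using exp1_ge2 by (simp add: monomial_bound_def add_nonneg_nonneg)

lemma log_weight_monomial_le:
  assumes "exp 1 \<le> \<theta>" "k \<in> {1, 2}" "1 \<le> j" "cmod z < 1"
  shows "log_weight k \<theta> z * (real j * cmod z ^ (j - 1)) \<le> monomial_bound \<theta> * ln (real j + 1)"
proof -
  have "log_weight k \<theta> z * (real j * cmod z ^ (j - 1))
      \<le> 2 * ((1 - cmod z) * ln (\<theta> / (1 - cmod z))) * (real j * cmod z ^ (j - 1))"
    using log_weight_bounds(2)[OF assms(1,2,4)] by (intro mult_right_mono) auto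
  also have "\<dots> \<le> 2 * ((2 * exp 1 * ln \<theta> + exp 1 + 2) * ln (real j + 1))"
    using monomial_profile_upper[of \<theta> j "cmod z"] exp1_ge2 assms by (simp add: mult.assoc)
  finally show ?thesis by (simp only: monomial_bound_def mult.assoc)
qed

lemma deriv_power: "deriv (\<lambda>z. z ^ j) (z::complex) = of_nat j * z ^ (j - 1)"
  by (intro DERIV_imp_deriv) (auto intro!: derivative_eq_intros)

text \<open>The lower bound comes from the point \<open>r = 1 - 1/j\<close>, where \<open>1 / (1 - r)\<close> equals \<open>j\<close>.\<close>

lemma monomial_seminorm_bounds:
  assumes "1 \<le> j"
  shows "ennreal (1 / (2 * exp 1) * ln (real j + 1)) \<le> bloch_seminorm (log_weight 1 3) (\<lambda>z. z ^ j)"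
    and "bloch_seminorm (log_weight 1 3) (\<lambda>z. z ^ j) \<le> ennreal (monomial_bound 3 * ln (real j + 1))"
proof -
  define r where "r = 1 - 1 / real j"
  have r: "0 \<le> r" "r < 1" "1 / (1 - r) = real j" using assms by (auto simp: r_def)
  have "ln (real j + 1) \<le> 2 * exp 1 * ((1 - r) * ln (3 / (1 - r))) * (real j * r ^ (j - 1))"
    using r assms by (intro monomial_profile_lower) auto
  then have "1 / (2 * exp 1) * ln (real j + 1) \<le> log_weight 1 3 (of_real r) * cmod (deriv (\<lambda>z. z ^ j) (of_real r))"
    using r by (simp add: deriv_power log_weight_def norm_mult norm_power field_simps)
  then have "ennreal (1 / (2 * exp 1) * ln (real j + 1))
      \<le> ennreal (log_weight 1 3 (of_real r) * cmod (deriv (\<lambda>z. z ^ j) (of_real r)))"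
    by (rule ennreal_leI)
  also have "\<dots> \<le> bloch_seminorm (log_weight 1 3) (\<lambda>z. z ^ j)"
    unfolding bloch_seminorm_def using r by (intro SUP_upper) auto
  finally show "ennreal (1 / (2 * exp 1) * ln (real j + 1)) \<le> bloch_seminorm (log_weight 1 3) (\<lambda>z. z ^ j)" .
  show "bloch_seminorm (log_weight 1 3) (\<lambda>z. z ^ j) \<le> ennreal (monomial_bound 3 * ln (real j + 1))"
    using monomial_bound_ge1[of 3] exp_le log_weight_monomial_le[OF exp_le _ assms, of 1]
    by (subst bloch_seminorm_le_iff) (auto simp: deriv_power norm_mult norm_power)
qed

lemma bloch_seminorm_divide:
  assumes "f holomorphic_on unit_disc" "weight \<mu>" "0 < c"
  shows "bloch_seminorm \<mu> (\<lambda>z. f z / of_real c) = bloch_seminorm \<mu> f / ennreal c"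
  unfolding bloch_seminorm_def SUP_divide_ennreal
proof (rule SUP_cong)
  fix z :: complex assume z: "z \<in> unit_disc"
  have "f field_differentiable at z"
    using assms(1) z by (auto intro: holomorphic_on_imp_differentiable_at)
  then have "deriv (\<lambda>z. f z / of_real c) z = deriv f z / of_real c"
    by (intro deriv_cdivide_right)
  moreover have "0 < \<mu> z" using assms(2) z by (simp add: weight_def)
  ultimately show "ennreal (\<mu> z * cmod (deriv (\<lambda>z. f z / of_real c) z)) = ennreal (\<mu> z * cmod (deriv f z)) / ennreal c"
    using assms(3) by (simp add: divide_ennreal norm_divide)
qed simp

lemma ennreal_inverse_antimono: "a \<le> b \<Longrightarrow> inverse b \<le> inverse (a::ennreal)"
  by (cases "a = 0"; cases a; cases b)
    (auto simp: inverse_ennreal top_unique le_imp_inverse_le intro!: ennreal_leI)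

lemma divide_ennreal_mult:
  assumes "0 < c" "0 < l"
  shows "a / ennreal (c * l) = ennreal (1 / c) * (a / ennreal l)"
  using assms by (simp add: divide_ennreal_def inverse_ennreal ennreal_mult[symmetric] mult.left_commute inverse_eq_divide)

lemma le_of_divide_ennreal_le:
  assumes "a / ennreal l \<le> ennreal M" "0 < l" "0 \<le> M"
  shows "a \<le> ennreal (M * l)"
  using assms by (cases a) (auto simp: divide_ennreal ennreal_top_divide top_unique divide_le_eq ennreal_leI)

lemma limsup_le_cmult_ennreal:
  fixes f g :: "nat \<Rightarrow> ennreal"
  assumes "\<And>j. f j \<le> ennreal K * g j"
  shows "limsup f \<le> ennreal K * limsup g"
proof -
  have "limsup f \<le> limsup (\<lambda>j. ennreal K * g j)" using assms by (intro Limsup_mono) auto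
  also have "\<dots> = ennreal K * limsup g"
    by (rule Limsup_compose_continuous_mono)
      (auto intro!: ennreal_continuous_on_cmult continuous_on_id monoI mult_left_mono)
  finally show ?thesis .
qed

lemma tendsto_zero_le_cmult_ennreal:
  fixes f g :: "nat \<Rightarrow> ennreal"
  assumes "\<And>j. f j \<le> ennreal K * g j" "g \<longlonglongrightarrow> 0"
  shows "f \<longlonglongrightarrow> 0"
proof (rule tendsto_sandwich[of "\<lambda>_. 0"])
  show "(\<lambda>j. ennreal K * g j) \<longlonglongrightarrow> 0"
    using ennreal_tendsto_cmult[OF _ assms(2), of "ennreal K"] by simp
qed (use assms in auto)

lemma equiv_constI:
  assumes "A \<le> ennreal K * B" "B \<le> ennreal K * A" "0 < K"
  shows "equiv_const K A B"
proof -
  have "ennreal (1 / K) * A \<le> ennreal (1 / K) * (ennreal K * B)"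
    using assms(1) by (rule mult_left_mono) simp
  also have "\<dots> = B" using assms(3) by (simp add: mult.assoc[symmetric] ennreal_mult[symmetric])
  finally show ?thesis using assms(2) by (simp add: equiv_const_def)
qed

locale log_bloch_composition =
  fixes \<theta> :: real and k :: nat and \<mu> :: "complex \<Rightarrow> real" and \<phi> :: "complex \<Rightarrow> complex"
  assumes \<theta>: "exp 1 \<le> \<theta>" and k: "k \<in> {1, 2}" and \<mu>: "weight \<mu>"
    and \<phi>: "\<phi> holomorphic_on unit_disc" "\<phi> ` unit_disc \<subseteq> unit_disc"
begin

abbreviation "\<nu> \<equiv> log_weight k \<theta>"

sublocale radial_weight \<nu> using \<theta> k by (rule radial_weight_log_weight)

text \<open>The scaled monomials of the gliding hump argument. For \<open>j = 0\<close> the denominator is 0, so by the convention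
on division this is the zero function; hence the whole sequence vanishes at the origin.\<close>

definition unit_monomial :: "nat \<Rightarrow> complex \<Rightarrow> complex"
  where "unit_monomial j z = (if z \<in> unit_disc then z ^ j / of_real (monomial_bound \<theta> * ln (real j + 1)) else 0)"

text \<open>The two sequences of the theorem. At \<open>j = 0\<close> they take the value \<open>0 / 0 = 0\<close>, since a constant
function has seminorm 0; comparisons between them therefore hold for all \<open>j\<close>.\<close>

definition log_ratio :: "nat \<Rightarrow> ennreal"
  where "log_ratio j = bloch_seminorm \<mu> (\<lambda>z. \<phi> z ^ j) / ennreal (ln (real j + 1))"

definition norm_ratio :: "nat \<Rightarrow> ennreal"
  where "norm_ratio j = bloch_seminorm \<mu> (\<lambda>z. \<phi> z ^ j) / bloch_seminorm (log_weight 1 3) (\<lambda>z. z ^ j)"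

lemma ln_pos: "1 \<le> j \<Longrightarrow> 0 < ln (real j + 1)"
  by simp

lemma seminorm_power_0: "bloch_seminorm \<mu> (\<lambda>z. \<phi> z ^ 0) = 0"
  by (simp add: bloch_seminorm_def)

lemma norm_ratio_le: "norm_ratio j \<le> ennreal (2 * exp 1) * log_ratio j"
proof (cases "j = 0")
  case False
  then have j: "1 \<le> j" by simp
  have "norm_ratio j \<le> bloch_seminorm \<mu> (\<lambda>z. \<phi> z ^ j) / ennreal (1 / (2 * exp 1) * ln (real j + 1))"
    unfolding norm_ratio_def divide_ennreal_def
    by (intro mult_left_mono ennreal_inverse_antimono monomial_seminorm_bounds(1)[OF j]) simp
  also have "\<dots> = ennreal (2 * exp 1) * log_ratio j"
    unfolding log_ratio_def using ln_pos[OF j] by (subst divide_ennreal_mult) simp_all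
  finally show ?thesis .
next
  case True
  show ?thesis unfolding norm_ratio_def True seminorm_power_0 by simp
qed

lemma log_ratio_le: "log_ratio j \<le> ennreal (monomial_bound 3) * norm_ratio j"
proof (cases "j = 0")
  case False
  then have j: "1 \<le> j" by simp
  have b: "1 \<le> monomial_bound 3" by (intro monomial_bound_ge1 exp_le)
  have "log_ratio j = ennreal (monomial_bound 3) *
      (bloch_seminorm \<mu> (\<lambda>z. \<phi> z ^ j) / ennreal (monomial_bound 3 * ln (real j + 1)))"
    unfolding log_ratio_def using ln_pos[OF j] b
    by (subst divide_ennreal_mult) (simp_all add: mult.assoc[symmetric] ennreal_mult[symmetric])
  also have "\<dots> \<le> ennreal (monomial_bound 3) * norm_ratio j"
    unfolding norm_ratio_def divide_ennreal_def
    by (intro mult_left_mono ennreal_inverse_antimono monomial_seminorm_bounds(2)[OF j]) simp_all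
  finally show ?thesis .
next
  case True
  show ?thesis unfolding log_ratio_def True seminorm_power_0 by simp
qed

lemma deriv_unit_monomial:
  assumes "z \<in> unit_disc"
  shows "deriv (unit_monomial j) z = of_nat j * z ^ (j - 1) / of_real (monomial_bound \<theta> * ln (real j + 1))"
proof -
  have "\<forall>\<^sub>F w in nhds z. unit_monomial j w = w ^ j / of_real (monomial_bound \<theta> * ln (real j + 1))"
    using assms by (auto simp: eventually_nhds unit_monomial_def intro!: exI[of _ unit_disc])
  then have "deriv (unit_monomial j) z = deriv (\<lambda>w. w ^ j / of_real (monomial_bound \<theta> * ln (real j + 1))) z"
    by (intro deriv_cong_ev) auto
  also have "\<dots> = deriv (\<lambda>w. w ^ j) z / of_real (monomial_bound \<theta> * ln (real j + 1))"
    by (intro deriv_cdivide_right holomorphic_on_imp_differentiable_at[of _ UNIV] holomorphic_intros) auto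
  finally show ?thesis by (simp add: deriv_power)
qed

lemma cmod_deriv_unit_monomial:
  assumes "z \<in> unit_disc"
  shows "cmod (deriv (unit_monomial j) z) = real j * cmod z ^ (j - 1) / (monomial_bound \<theta> * ln (real j + 1))"
  using assms monomial_bound_ge1[OF \<theta>]
  by (simp add: deriv_unit_monomial norm_divide norm_mult norm_power)

lemma unit_monomial_at_0: "unit_monomial j 0 = 0"
  by (cases j) (auto simp: unit_monomial_def)

lemma unit_monomial_in_unit_ball: "unit_monomial j \<in> unit_ball \<nu>"
proof -
  have d: "\<nu> z * cmod (deriv (unit_monomial j) z) \<le> 1" if z: "z \<in> unit_disc" for z
  proof (cases "j = 0")
    case False
    then have j: "1 \<le> j" by simp
    have "0 < monomial_bound \<theta> * ln (real j + 1)" using monomial_bound_ge1[OF \<theta>] ln_pos[OF j] by simp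
    then show ?thesis
      using log_weight_monomial_le[OF \<theta> k j, of z] z by (simp add: cmod_deriv_unit_monomial divide_le_eq)
  qed (use z in \<open>simp add: deriv_unit_monomial\<close>)
  have "(\<lambda>z. z ^ j / of_real (monomial_bound \<theta> * ln (real j + 1))) holomorphic_on unit_disc"
    by (cases "j = 0") (use monomial_bound_ge1[OF \<theta>] ln_pos[of j] in \<open>auto intro!: holomorphic_intros\<close>)
  then have "unit_monomial j holomorphic_on unit_disc"
    by (rule holomorphic_transform) (auto simp: unit_monomial_def)
  then have "unit_monomial j \<in> hol_disc" by (auto simp: hol_disc_def unit_monomial_def)
  then have "unit_monomial j \<in> bloch_space \<nu>" using d by (rule bloch_spaceI)
  moreover have "bloch_norm \<nu> (unit_monomial j) \<le> 0 + 1" using d by (intro bloch_norm_le) (auto simp: unit_monomial_at_0)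
  ultimately show ?thesis by (simp add: unit_ball_def)
qed

lemma unit_monomial_vanishes_at_boundary:
  assumes "0 < \<epsilon>"
  shows "\<exists>s<1. \<forall>z\<in>unit_disc. s < cmod z \<longrightarrow> \<nu> z * cmod (deriv (unit_monomial j) z) \<le> \<epsilon>"
proof -
  \<comment> \<open>A bound for the derivative on the whole disc; the 1 keeps it positive for \<open>j = 0\<close>.\<close>
  define M where "M = 1 + real j / \<bar>monomial_bound \<theta> * ln (real j + 1)\<bar>"
  have M: "1 \<le> M" by (simp add: M_def)
  have th: "0 < \<theta>" using \<theta> exp_gt_zero[of "1::real"] by linarith
  \<comment> \<open>Chosen so that \<open>4 sqrt (\<theta> (1 - s)) = \<epsilon> / M\<close>.\<close>
  define s where "s = 1 - (\<epsilon> / M / 4)\<^sup>2 / \<theta>"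
  have "s < 1" using assms M th by (simp add: s_def)
  moreover have "\<nu> z * cmod (deriv (unit_monomial j) z) \<le> \<epsilon>" if z: "z \<in> unit_disc" "s < cmod z" for z
  proof -
    have "\<theta> * (1 - cmod z) \<le> (\<epsilon> / M / 4)\<^sup>2"
    proof -
      have "1 - cmod z \<le> (\<epsilon> / M / 4)\<^sup>2 / \<theta>" using z(2) by (simp add: s_def)
      then have "\<theta> * (1 - cmod z) \<le> \<theta> * ((\<epsilon> / M / 4)\<^sup>2 / \<theta>)"
        using th by (intro mult_left_mono) auto
      then show ?thesis using th by simp
    qed
    then have "sqrt (\<theta> * (1 - cmod z)) \<le> \<epsilon> / M / 4"
      using assms M by (intro real_le_lsqrt) auto
    then have "\<nu> z \<le> \<epsilon> / M" using log_weight_le_sqrt[OF \<theta> k, of z] z by simp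
    moreover have "cmod (deriv (unit_monomial j) z) \<le> M"
    proof -
      have "real j * cmod z ^ (j - 1) \<le> real j * 1"
        using z by (intro mult_left_mono power_le_one) auto
      then have "real j * cmod z ^ (j - 1) / (monomial_bound \<theta> * ln (real j + 1))
          \<le> real j / (monomial_bound \<theta> * ln (real j + 1))"
        using monomial_bound_ge1[OF \<theta>] by (intro divide_right_mono) auto
      also have "\<dots> \<le> M" using monomial_bound_ge1[OF \<theta>] by (simp add: M_def)
      finally show ?thesis using z by (simp add: cmod_deriv_unit_monomial)
    qed
    ultimately have "\<nu> z * cmod (deriv (unit_monomial j) z) \<le> \<epsilon> / M * M"
      using assms M by - (rule mult_mono, auto)
    then show ?thesis using M by simp
  qed
  ultimately show ?thesis by blast
qed

lemma unit_monomial_locally_null: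
  assumes s: "s < 1" and \<epsilon>: "0 < \<epsilon>"
  shows "\<forall>\<^sub>F j in sequentially. \<forall>z. cmod z \<le> s \<longrightarrow> \<nu> z * cmod (deriv (unit_monomial j) z) \<le> \<epsilon>"
proof -
  \<comment> \<open>Enlarging \<open>s\<close> makes division by \<open>t\<close> possible, even if \<open>s \<le> 0\<close>.\<close>
  define t where "t = max s (1 / 2)"
  have t: "0 < t" "t < 1" "s \<le> t" using s by (auto simp: t_def)
  have n0: "0 < \<nu> 0" by (intro pos) simp
  have "(\<lambda>j. real j * t ^ j) \<longlonglongrightarrow> 0" using t by (intro powser_times_n_limit_0) auto
  moreover have "0 < \<epsilon> * t * ln 2 / \<nu> 0" using t \<epsilon> n0 by simp
  ultimately have "\<forall>\<^sub>F j in sequentially. real j * t ^ j < \<epsilon> * t * ln 2 / \<nu> 0"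
    by (rule order_tendstoD(2))
  then show ?thesis using eventually_ge_at_top[of 1]
  proof eventually_elim
    case (elim j)
    show ?case
    proof (intro allI impI)
      fix z :: complex assume "cmod z \<le> s"
      then have z: "cmod z \<le> t" "z \<in> unit_disc" using t by auto
      have l2: "ln 2 \<le> monomial_bound \<theta> * ln (real j + 1)"
        using mult_mono[OF monomial_bound_ge1[OF \<theta>], of "ln 2" "ln (real j + 1)"] elim(2)
          monomial_bound_ge1[OF \<theta>] by simp
      have "real j * cmod z ^ (j - 1) \<le> real j * t ^ (j - 1)"
        using z by (intro mult_left_mono power_mono) auto
      also have "\<dots> = real j * t ^ j / t" using elim(2) t by (simp add: power_diff)
      finally have "cmod (deriv (unit_monomial j) z) \<le> (real j * t ^ j / t) / ln 2"
        unfolding cmod_deriv_unit_monomial[OF z(2)] using t l2 by (intro frac_le) auto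
      moreover have "\<nu> z \<le> \<nu> 0" using z by (intro antimono) auto
      ultimately have "\<nu> z * cmod (deriv (unit_monomial j) z) \<le> \<nu> 0 * ((real j * t ^ j / t) / ln 2)"
        using n0 by - (rule mult_mono, auto)
      also have "\<dots> \<le> \<epsilon>" using elim(1) n0 t by (simp add: field_simps)
      finally show "\<nu> z * cmod (deriv (unit_monomial j) z) \<le> \<epsilon>" .
    qed
  qed
qed

lemma compact_op_unit_monomial_null: "compact_op \<nu> \<mu> S \<Longrightarrow> (\<lambda>j. bloch_norm \<mu> (S (unit_monomial j))) \<longlonglongrightarrow> 0"
  using weight \<mu> by (rule compact_op_null[where e = unit_monomial])
    (auto intro: unit_monomial_in_unit_ball unit_monomial_at_0 unit_monomial_vanishes_at_boundary unit_monomial_locally_null)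

lemma log_ratio_eq: "log_ratio j = ennreal (monomial_bound \<theta>) * bloch_seminorm \<mu> (comp_op \<phi> (unit_monomial j))"
proof (cases "j = 0")
  case True
  have "deriv (comp_op \<phi> (unit_monomial 0)) z = 0" if "z \<in> unit_disc" for z
    using deriv_comp_op[OF \<phi> _ that, of "unit_monomial 0"] bloch_space_holomorphic[of "unit_monomial 0" \<nu>] unit_monomial_in_unit_ball[of 0]
      deriv_unit_monomial[of "\<phi> z" 0] image_subset_iff[THEN iffD1, OF \<phi>(2), rule_format, OF that]
    by (simp add: unit_ball_def)
  then have "bloch_seminorm \<mu> (comp_op \<phi> (unit_monomial 0)) = 0" by (simp add: bloch_seminorm_def)
  then show ?thesis unfolding log_ratio_def True seminorm_power_0 by simp
next
  case False
  then have j: "1 \<le> j" by simp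
  let ?c = "monomial_bound \<theta> * ln (real j + 1)"
  have b: "1 \<le> monomial_bound \<theta>" by (rule monomial_bound_ge1[OF \<theta>])
  have "bloch_seminorm \<mu> (comp_op \<phi> (unit_monomial j)) = bloch_seminorm \<mu> (\<lambda>z. \<phi> z ^ j / of_real ?c)"
    using \<phi>(2)[unfolded image_subset_iff]
    by (intro bloch_seminorm_cong) (simp add: comp_op_def unit_monomial_def del: mem_ball_0)
  also have "\<dots> = bloch_seminorm \<mu> (\<lambda>z. \<phi> z ^ j) / ennreal ?c"
    using \<mu> b ln_pos[OF j] by (intro bloch_seminorm_divide holomorphic_intros \<phi>) auto
  also have "\<dots> = ennreal (1 / monomial_bound \<theta>) * log_ratio j"
    unfolding log_ratio_def using b ln_pos[OF j] by (intro divide_ennreal_mult) auto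
  finally show ?thesis using b by (simp add: mult.assoc[symmetric] ennreal_mult[symmetric])
qed

lemma log_ratio_finite:
  assumes "comp_op \<phi> ` bloch_space \<nu> \<subseteq> bloch_space \<mu>"
  shows "log_ratio j < \<infinity>"
proof -
  have "comp_op \<phi> (unit_monomial j) \<in> bloch_space \<mu>" using assms unit_monomial_in_unit_ball[of j] by (auto simp: unit_ball_def)
  then show ?thesis by (simp add: log_ratio_eq ennreal_mult_less_top bloch_space_def)
qed

text \<open>The key estimate: with \<open>r = |\<phi> z|\<close> and \<open>j\<close> the integer part of \<open>1 / (1 - r)\<close>, the bound for
\<open>\<phi>\<^sup>j\<close> at \<open>z\<close> and \<open>monomial_profile_lower\<close> have the common factor \<open>j r\<^bsup>j-1\<^esup>\<close>, which
cancels. The condition \<open>r \<ge> 1 - 1/J\<close> ensures \<open>j \<ge> J\<close>, so bounds for large powers control \<open>\<phi>'\<close> where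
\<open>|\<phi>|\<close> is close to 1, and \<open>J = 1\<close> covers the whole disc.\<close>

lemma symbol_bound:
  assumes M: "\<And>j. J \<le> j \<Longrightarrow> log_ratio j \<le> ennreal M" "0 \<le> M" "1 \<le> J"
    and z: "z \<in> unit_disc" "1 - 1 / real J \<le> cmod (\<phi> z)"
  shows "\<mu> z * cmod (deriv \<phi> z) \<le> 2 * exp 1 * M * \<nu> (\<phi> z)"
proof -
  define r where "r = cmod (\<phi> z)"
  have w: "\<phi> z \<in> unit_disc" using z(1) \<phi>(2) by blast
  then have r: "0 \<le> r" "r < 1" by (auto simp: r_def)
  obtain j where j: "1 \<le> j" "real j \<le> 1 / (1 - r)" "1 / (1 - r) < real j + 1"
    by (rule ex_nat_near_inverse[OF r])
  have "1 - 1 / real J \<le> r" using z(2) by (simp add: r_def)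
  then have "real J \<le> 1 / (1 - r)" using M(3) r by (simp add: field_simps)
  then have "J \<le> j" using j by linarith
  then have "bloch_seminorm \<mu> (\<lambda>z. \<phi> z ^ j) \<le> ennreal (M * ln (real j + 1))"
    using M(1)[of j] M(2) ln_pos[OF j(1)] unfolding log_ratio_def by (intro le_of_divide_ennreal_le)
  then have "\<mu> z * cmod (deriv (\<lambda>z. \<phi> z ^ j) z) \<le> M * ln (real j + 1)"
    using z(1) M(2) j(1) by (subst (asm) bloch_seminorm_le_iff) auto
  moreover have "deriv (\<lambda>z. \<phi> z ^ j) z = of_nat j * \<phi> z ^ (j - 1) * deriv \<phi> z"
  proof (rule DERIV_imp_deriv)
    have "(\<phi> has_field_derivative deriv \<phi> z) (at z)"
      by (rule holomorphic_derivI[OF \<phi>(1) _ z(1)]) simp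
    then show "((\<lambda>z. \<phi> z ^ j) has_field_derivative of_nat j * \<phi> z ^ (j - 1) * deriv \<phi> z) (at z)"
      by (auto intro!: derivative_eq_intros)
  qed
  ultimately have "(\<mu> z * cmod (deriv \<phi> z)) * (real j * r ^ (j - 1)) \<le> M * ln (real j + 1)"
    by (simp add: norm_mult norm_power r_def mult_ac)
  also have "\<dots> \<le> M * (2 * exp 1 * ((1 - r) * ln (\<theta> / (1 - r))) * (real j * r ^ (j - 1)))"
    using monomial_profile_lower[OF _ j(1) r j(2,3), of \<theta>] exp1_ge2 \<theta> M(2) by (intro mult_left_mono) auto
  also have "\<dots> = (2 * exp 1 * M * ((1 - r) * ln (\<theta> / (1 - r)))) * (real j * r ^ (j - 1))"
    by (simp add: mult_ac)
  finally have "(\<mu> z * cmod (deriv \<phi> z)) * (real j * r ^ (j - 1))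
      \<le> (2 * exp 1 * M * ((1 - r) * ln (\<theta> / (1 - r)))) * (real j * r ^ (j - 1))" .
  moreover have "0 < real j * r ^ (j - 1)"
  proof -
    have "1 - 1 / real j \<le> r" using j r by (simp add: field_simps)
    then have "0 < r ^ (j - 1)" using exp_le_power[OF j(1)] exp_gt_zero[of "-1::real"] by (meson less_le_trans)
    then show ?thesis using j(1) by simp
  qed
  ultimately have "\<mu> z * cmod (deriv \<phi> z) \<le> 2 * exp 1 * M * ((1 - r) * ln (\<theta> / (1 - r)))"
    by (rule mult_right_le_imp_le)
  also have "\<dots> \<le> 2 * exp 1 * M * \<nu> (\<phi> z)"
    using log_weight_bounds(1)[OF \<theta> k, of "\<phi> z"] r M(2) by (intro mult_left_mono) (auto simp: r_def)
  finally show ?thesis .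
qed

text \<open>A bounded tail says nothing about the finitely many earlier terms, which are extended real numbers and
might be infinite.\<close>

lemma log_ratio_bounded:
  assumes "\<And>j. 1 \<le> j \<Longrightarrow> log_ratio j < \<infinity>" "\<forall>\<^sub>F j in sequentially. log_ratio j \<le> ennreal c"
  obtains M where "0 \<le> M" "\<And>j. 1 \<le> j \<Longrightarrow> log_ratio j \<le> ennreal M"
proof -
  obtain N where N: "\<And>j. N \<le> j \<Longrightarrow> log_ratio j \<le> ennreal c"
    using assms(2) by (auto simp: eventually_sequentially)
  define M where "M = max c 0 + (\<Sum>j<N. enn2real (log_ratio j))"
  have s0: "0 \<le> (\<Sum>j<N. enn2real (log_ratio j))" by (intro sum_nonneg) auto
  have "log_ratio j \<le> ennreal M" if j: "1 \<le> j" for j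
  proof (cases "j < N")
    case True
    then have "enn2real (log_ratio j) \<le> (\<Sum>j<N. enn2real (log_ratio j))"
      by (intro member_le_sum) auto
    then have "ennreal (enn2real (log_ratio j)) \<le> ennreal M" by (intro ennreal_leI) (simp add: M_def)
    then show ?thesis using assms(1)[OF j] by simp
  next
    case False
    then have "log_ratio j \<le> ennreal c" by (intro N) simp
    also have "\<dots> \<le> ennreal M" using s0 by (intro ennreal_leI) (simp add: M_def)
    finally show ?thesis .
  qed
  moreover have "0 \<le> M" using s0 by (simp add: M_def)
  ultimately show thesis using that by blast
qed

lemma bounded_iff_log_ratio: "bounded_op \<nu> \<mu> (comp_op \<phi>) \<longleftrightarrow> (SUP j\<in>{1..}. log_ratio j) < \<infinity>"
proof
  assume "bounded_op \<nu> \<mu> (comp_op \<phi>)"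
  then obtain C where lin: "linear_op \<nu> \<mu> (comp_op \<phi>)"
    and C: "\<And>f. f \<in> bloch_space \<nu> \<Longrightarrow> bloch_norm \<mu> (comp_op \<phi> f) \<le> C * bloch_norm \<nu> f"
    by (auto simp: bounded_op_def)
  have "log_ratio j \<le> ennreal (monomial_bound \<theta>) * ennreal \<bar>C\<bar>" for j
  proof -
    have ej: "unit_monomial j \<in> bloch_space \<nu>" "bloch_norm \<nu> (unit_monomial j) \<le> 1" using unit_monomial_in_unit_ball[of j] by (auto simp: unit_ball_def)
    then have "comp_op \<phi> (unit_monomial j) \<in> bloch_space \<mu>" using lin by (auto simp: linear_op_def)
    then have "bloch_seminorm \<mu> (comp_op \<phi> (unit_monomial j)) \<le> ennreal (bloch_norm \<mu> (comp_op \<phi> (unit_monomial j)))"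
      by (rule bloch_seminorm_le_norm)
    also have "bloch_norm \<mu> (comp_op \<phi> (unit_monomial j)) \<le> C * bloch_norm \<nu> (unit_monomial j)" by (rule C[OF ej(1)])
    also have "\<dots> \<le> \<bar>C\<bar> * 1" using ej(2) bloch_norm_nonneg[of \<nu> "unit_monomial j"] by (intro mult_mono) auto
    finally have "bloch_seminorm \<mu> (comp_op \<phi> (unit_monomial j)) \<le> ennreal \<bar>C\<bar>" by (simp add: ennreal_leI)
    then show ?thesis unfolding log_ratio_eq by (intro mult_left_mono) auto
  qed
  then have "(SUP j\<in>{1..}. log_ratio j) \<le> ennreal (monomial_bound \<theta>) * ennreal \<bar>C\<bar>" by (intro SUP_least)
  also have "\<dots> < \<infinity>" by (simp add: ennreal_mult_less_top)
  finally show "(SUP j\<in>{1..}. log_ratio j) < \<infinity>" .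
next
  assume fin: "(SUP j\<in>{1..}. log_ratio j) < \<infinity>"
  define M where "M = enn2real (SUP j\<in>{1..}. log_ratio j)"
  have M: "log_ratio j \<le> ennreal M" if "1 \<le> j" for j
    using SUP_upper[of j "{1..}" log_ratio] that fin by (simp add: M_def)
  show "bounded_op \<nu> \<mu> (comp_op \<phi>)"
    using symbol_bound[of 1 M] M by (intro comp_op_bounded[OF \<phi>, of \<mu> "2 * exp 1 * M"]) (auto simp: M_def)
qed

lemma compact_iff_log_ratio:
  "compact_op \<nu> \<mu> (comp_op \<phi>) \<longleftrightarrow> (\<forall>j\<ge>1. log_ratio j < \<infinity>) \<and> log_ratio \<longlonglongrightarrow> 0"
proof (intro iffI conjI allI impI)
  assume T: "compact_op \<nu> \<mu> (comp_op \<phi>)"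
  then have maps: "comp_op \<phi> ` bloch_space \<nu> \<subseteq> bloch_space \<mu>" by (simp add: compact_op_def linear_op_def)
  then show "log_ratio j < \<infinity>" for j by (rule log_ratio_finite)
  have "(\<lambda>j. ennreal (bloch_norm \<mu> (comp_op \<phi> (unit_monomial j)))) \<longlonglongrightarrow> 0"
    using compact_op_unit_monomial_null[OF T] by (simp add: ennreal_tendsto_0_iff bloch_norm_nonneg)
  moreover have "log_ratio j \<le> ennreal (monomial_bound \<theta>) * ennreal (bloch_norm \<mu> (comp_op \<phi> (unit_monomial j)))" for j
    unfolding log_ratio_eq using maps unit_monomial_in_unit_ball[of j]
    by (intro mult_left_mono bloch_seminorm_le_norm) (auto simp: unit_ball_def)
  ultimately show "log_ratio \<longlonglongrightarrow> 0" by (rule tendsto_zero_le_cmult_ennreal[rotated])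
next
  assume A: "(\<forall>j\<ge>1. log_ratio j < \<infinity>) \<and> log_ratio \<longlonglongrightarrow> 0"
  have ev: "\<forall>\<^sub>F j in sequentially. log_ratio j \<le> ennreal c" if "0 < c" for c
  proof -
    have "\<forall>\<^sub>F j in sequentially. log_ratio j < ennreal c"
      using A that by (intro order_tendstoD(2)[of log_ratio 0]) auto
    then show ?thesis by eventually_elim (rule less_imp_le)
  qed
  obtain M where M: "0 \<le> M" "\<And>j. 1 \<le> j \<Longrightarrow> log_ratio j \<le> ennreal M"
    by (rule log_ratio_bounded[OF _ ev[of 1]]) (use A in auto)
  show "compact_op \<nu> \<mu> (comp_op \<phi>)"
  proof (rule comp_op_compact[OF \<mu> \<phi>, of "2 * exp 1 * M"])
    show "\<mu> z * cmod (deriv \<phi> z) \<le> 2 * exp 1 * M * \<nu> (\<phi> z)" if "z \<in> unit_disc" for z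
      using symbol_bound[of 1 M z] M that by simp
    fix \<epsilon> :: real assume \<epsilon>: "0 < \<epsilon>"
    then obtain J where J: "\<And>j. J \<le> j \<Longrightarrow> log_ratio j \<le> ennreal (\<epsilon> / (2 * exp 1))"
      using ev[of "\<epsilon> / (2 * exp 1)"] by (auto simp: eventually_sequentially)
    have "\<mu> z * cmod (deriv \<phi> z) \<le> 2 * exp 1 * (\<epsilon> / (2 * exp 1)) * \<nu> (\<phi> z)"
      if "z \<in> unit_disc" "1 - 1 / real (max J 1) < cmod (\<phi> z)" for z
      using J \<epsilon> that by (intro symbol_bound[of "max J 1"]) auto
    then show "\<exists>s<1. \<forall>z\<in>unit_disc. s < cmod (\<phi> z) \<longrightarrow> \<mu> z * cmod (deriv \<phi> z) \<le> \<epsilon> * \<nu> (\<phi> z)"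
      by (intro exI[of _ "1 - 1 / real (max J 1)"]) auto
  qed (use M in auto)
qed

lemma limsup_log_ratio_le:
  assumes "comp_op \<phi> ` bloch_space \<nu> \<subseteq> bloch_space \<mu>"
  shows "limsup log_ratio \<le> ennreal (monomial_bound \<theta>) * ess_norm \<nu> \<mu> (comp_op \<phi>)"
proof -
  have "limsup log_ratio \<le> ennreal (monomial_bound \<theta>) * limsup (\<lambda>j. bloch_seminorm \<mu> (comp_op \<phi> (unit_monomial j)))"
    by (rule limsup_le_cmult_ennreal) (simp add: log_ratio_eq)
  also have "\<dots> \<le> ennreal (monomial_bound \<theta>) * ess_norm \<nu> \<mu> (comp_op \<phi>)"
    by (intro mult_left_mono limsup_le_ess_norm[OF weight \<mu> assms] unit_monomial_in_unit_ball compact_op_unit_monomial_null) auto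
  finally show ?thesis .
qed

text \<open>If the upper limit is infinite there is nothing to show. Otherwise the ratios are bounded, and the
quotient \<open>\<mu> |\<phi>'| / \<nu> \<circ> \<phi>\<close> is at most \<open>2 e c\<close> near the boundary for every \<open>c\<close> above the
upper limit; \<open>ess_norm_comp_op_le\<close> contributes another factor 2.\<close>

lemma ess_norm_le_limsup:
  assumes "comp_op \<phi> ` bloch_space \<nu> \<subseteq> bloch_space \<mu>"
  shows "ess_norm \<nu> \<mu> (comp_op \<phi>) \<le> ennreal (4 * exp 1) * limsup log_ratio"
proof (cases "limsup log_ratio")
  case (real l)
  show ?thesis
  proof (rule ennreal_le_epsilon)
    fix \<epsilon> :: real assume \<epsilon>: "0 < \<epsilon>"
    define c where "c = l + \<epsilon> / (4 * exp 1)"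
    have c: "l < c" "0 \<le> c" using \<epsilon> real by (auto simp: c_def add_nonneg_nonneg)
    then have "limsup log_ratio < ennreal c" using real by (simp add: ennreal_lessI)
    then have ev: "\<forall>\<^sub>F j in sequentially. log_ratio j \<le> ennreal c"
      by (auto dest!: Limsup_lessD elim!: eventually_mono)
    obtain M where M: "0 \<le> M" "\<And>j. 1 \<le> j \<Longrightarrow> log_ratio j \<le> ennreal M"
      by (rule log_ratio_bounded[OF log_ratio_finite[OF assms] ev]) blast
    obtain J where J: "\<And>j. J \<le> j \<Longrightarrow> log_ratio j \<le> ennreal c"
      using ev by (auto simp: eventually_sequentially)
    have "ess_norm \<nu> \<mu> (comp_op \<phi>) \<le> ennreal (2 * (2 * exp 1 * c))"
    proof (rule ess_norm_comp_op_le[OF \<mu> \<phi>, of "2 * exp 1 * M" "1 - 1 / real (max J 1)"])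
      show "\<mu> z * cmod (deriv \<phi> z) \<le> 2 * exp 1 * M * \<nu> (\<phi> z)" if "z \<in> unit_disc" for z
        using symbol_bound[of 1 M z] M that by simp
      show "\<mu> z * cmod (deriv \<phi> z) \<le> 2 * exp 1 * c * \<nu> (\<phi> z)"
        if "z \<in> unit_disc" "1 - 1 / real (max J 1) < cmod (\<phi> z)" for z
        using J c that by (intro symbol_bound[of "max J 1"]) auto
    qed (use M c in auto)
    also have "2 * (2 * exp 1 * c) = 4 * exp 1 * l + \<epsilon>" by (simp add: c_def field_simps)
    also have "ennreal (4 * exp 1 * l + \<epsilon>) = ennreal (4 * exp 1) * limsup log_ratio + ennreal \<epsilon>"
      using real \<epsilon> by (simp add: ennreal_mult)
    finally show "ess_norm \<nu> \<mu> (comp_op \<phi>) \<le> ennreal (4 * exp 1) * limsup log_ratio + ennreal \<epsilon>" .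
  qed
qed (simp add: ennreal_mult_top)

lemma sup_norm_ratio_iff: "(SUP j\<in>{1..}. norm_ratio j) < \<infinity> \<longleftrightarrow> (SUP j\<in>{1..}. log_ratio j) < \<infinity>"
proof -
  have *: "(SUP j\<in>{1..}. f j) < \<infinity>" if "\<And>j. f j \<le> ennreal K * g j" "(SUP j\<in>{1..}. g j) < \<infinity>"
    for f g :: "nat \<Rightarrow> ennreal" and K
  proof -
    have "(SUP j\<in>{1..}. f j) \<le> ennreal K * (SUP j\<in>{1..}. g j)"
    proof (rule SUP_least)
      fix j :: nat assume "j \<in> {1..}"
      then have "ennreal K * g j \<le> ennreal K * (SUP j\<in>{1..}. g j)" by (intro mult_left_mono SUP_upper) auto
      then show "f j \<le> ennreal K * (SUP j\<in>{1..}. g j)" using that(1)[of j] by (rule order_trans[rotated])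
    qed
    also have "\<dots> < \<infinity>" using that(2) by (simp add: ennreal_mult_less_top)
    finally show ?thesis .
  qed
  show ?thesis using *[of norm_ratio _ log_ratio, OF norm_ratio_le] *[of log_ratio _ norm_ratio, OF log_ratio_le] by blast
qed

lemma norm_ratio_finite_iff: "norm_ratio j < \<infinity> \<longleftrightarrow> log_ratio j < \<infinity>"
  using norm_ratio_le[of j] log_ratio_le[of j]
  by (auto simp: ennreal_mult_less_top elim!: le_less_trans)

lemma norm_ratio_null_iff: "norm_ratio \<longlonglongrightarrow> 0 \<longleftrightarrow> log_ratio \<longlonglongrightarrow> 0"
  using tendsto_zero_le_cmult_ennreal[of norm_ratio _ log_ratio, OF norm_ratio_le]
    tendsto_zero_le_cmult_ennreal[of log_ratio _ norm_ratio, OF log_ratio_le] by blast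

text \<open>The comparisons between the three quantities compose to estimates in all directions, and \<open>K\<close>
dominates every constant and every product of two constants that occurs.\<close>

lemma ess_norm_ratios_equiv:
  fixes K
  defines "K \<equiv> 8 * exp 1 * monomial_bound 3 * monomial_bound \<theta>"
  assumes maps: "comp_op \<phi> ` bloch_space \<nu> \<subseteq> bloch_space \<mu>"
    and AB: "A \<in> {ess_norm \<nu> \<mu> (comp_op \<phi>), limsup norm_ratio, limsup log_ratio}"
      "B \<in> {ess_norm \<nu> \<mu> (comp_op \<phi>), limsup norm_ratio, limsup log_ratio}"
  shows "equiv_const K A B"
proof -
  let ?E = "ess_norm \<nu> \<mu> (comp_op \<phi>)" and ?a = "monomial_bound \<theta>" and ?b = "monomial_bound 3"
  have ab: "1 \<le> ?a" "1 \<le> ?b" "1 \<le> exp (1::real)"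
    using monomial_bound_ge1[OF \<theta>] monomial_bound_ge1[OF exp_le] by auto
  have p: "1 \<le> ?b * ?a" using mult_mono[OF ab(2,1)] ab by simp
  have K: "0 < K" "1 \<le> K" "4 * exp 1 \<le> K" "2 * exp 1 \<le> K" "?a \<le> K" "?b \<le> K"
      "4 * exp 1 * ?b \<le> K" "2 * exp 1 * ?a \<le> K"
  proof -
    have e: "8 * exp 1 * (?b * ?a) = K" by (simp add: K_def)
    have ep: "(1::real) \<le> 8 * exp 1" using exp1_ge2 by linarith
    have ba: "?b \<le> ?b * ?a" "?a \<le> ?b * ?a"
      using mult_left_mono[OF ab(1), of ?b] mult_right_mono[OF ab(2), of ?a] ab by auto
    have m: "x * y \<le> K" if "x \<le> 8 * exp 1" "y \<le> ?b * ?a" "0 \<le> x" "0 \<le> y" for x y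
      using mult_mono[OF that(1,2)] that(3,4) ab(3) unfolding e by simp
    show "1 \<le> K" "4 * exp 1 \<le> K" "2 * exp 1 \<le> K" "?a \<le> K" "?b \<le> K"
      using m[of 1 1] m[of "4 * exp 1" 1] m[of "2 * exp 1" 1] m[of 1 ?a] m[of 1 ?b] ep ba p ab by simp_all
    then show "0 < K" by simp
    show "4 * exp 1 * ?b \<le> K" "2 * exp 1 * ?a \<le> K"
      using m[of "4 * exp 1" ?b] m[of "2 * exp 1" ?a] ba ab by simp_all
  qed
  have up: "X \<le> ennreal K * Y" if "X \<le> ennreal x * Y" "x \<le> K" for X Y x
    using that(1) mult_right_mono[OF ennreal_leI[OF that(2)], of Y] by (rule order_trans) simp
  have tr: "X \<le> ennreal (x * y) * Z" if "X \<le> ennreal x * Y" "Y \<le> ennreal y * Z" "0 \<le> x" "0 \<le> y" for X Y Z x y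
    using that(1) mult_left_mono[OF that(2), of "ennreal x"] that(3,4)
    by (simp add: ennreal_mult mult.assoc)
  note EL = ess_norm_le_limsup[OF maps] and LE = limsup_log_ratio_le[OF maps]
    and NL = limsup_le_cmult_ennreal[OF norm_ratio_le] and LN = limsup_le_cmult_ennreal[OF log_ratio_le]
  have EN: "?E \<le> ennreal (4 * exp 1 * ?b) * limsup norm_ratio" using ab by (intro tr[OF EL LN]) auto
  have NE: "limsup norm_ratio \<le> ennreal (2 * exp 1 * ?a) * ?E" using ab by (intro tr[OF NL LE]) auto
  have refl: "X \<le> ennreal 1 * X" for X by simp
  have "X \<le> ennreal K * Y" if "X \<in> {?E, limsup norm_ratio, limsup log_ratio}"
    "Y \<in> {?E, limsup norm_ratio, limsup log_ratio}" for X Y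
    using that up[OF EL K(3)] up[OF LE K(5)] up[OF NL K(4)] up[OF LN K(6)] up[OF EN K(7)] up[OF NE K(8)]
      up[OF refl K(2)] by auto
  then show ?thesis using AB K(1) by (intro equiv_constI) auto
qed

end

theorem theorem7p1:
  fixes \<theta> :: real and k :: nat
  assumes "exp 1 \<le> \<theta>" and "k \<in> {1, 2}"
  shows
    "(\<forall>\<phi> \<mu>. \<phi> holomorphic_on unit_disc \<and> \<phi> ` unit_disc \<subseteq> unit_disc \<and> weight \<mu> \<longrightarrow>
        (bounded_op (log_weight k \<theta>) \<mu> (comp_op \<phi>) \<longleftrightarrow>
           (SUP j\<in>{1::nat..}. bloch_seminorm \<mu> (\<lambda>z. \<phi> z ^ j) /
                              bloch_seminorm (log_weight 1 3) (\<lambda>z. z ^ j)) < \<infinity>) \<and>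
        (bounded_op (log_weight k \<theta>) \<mu> (comp_op \<phi>) \<longleftrightarrow>
           (SUP j\<in>{1::nat..}. bloch_seminorm \<mu> (\<lambda>z. \<phi> z ^ j) /
                              ennreal (ln (real j + 1))) < \<infinity>))
     \<and>
     (\<forall>\<phi> \<mu>. \<phi> holomorphic_on unit_disc \<and> \<phi> ` unit_disc \<subseteq> unit_disc \<and> weight \<mu> \<longrightarrow>
        (compact_op (log_weight k \<theta>) \<mu> (comp_op \<phi>) \<longleftrightarrow>
           (\<forall>j\<ge>1. bloch_seminorm \<mu> (\<lambda>z. \<phi> z ^ j) /
                   bloch_seminorm (log_weight 1 3) (\<lambda>z. z ^ j) < \<infinity>) \<and>
           (\<lambda>j. bloch_seminorm \<mu> (\<lambda>z. \<phi> z ^ j) /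
                bloch_seminorm (log_weight 1 3) (\<lambda>z. z ^ j)) \<longlonglongrightarrow> 0) \<and>
        (compact_op (log_weight k \<theta>) \<mu> (comp_op \<phi>) \<longleftrightarrow>
           (\<forall>j\<ge>1. bloch_seminorm \<mu> (\<lambda>z. \<phi> z ^ j) / ennreal (ln (real j + 1)) < \<infinity>) \<and>
           (\<lambda>j. bloch_seminorm \<mu> (\<lambda>z. \<phi> z ^ j) / ennreal (ln (real j + 1))) \<longlonglongrightarrow> 0))
     \<and>
     (\<exists>K>0. \<forall>\<phi> \<mu>. \<phi> holomorphic_on unit_disc \<and> \<phi> ` unit_disc \<subseteq> unit_disc \<and> weight \<mu> \<and>
        comp_op \<phi> ` bloch_space (log_weight k \<theta>) \<subseteq> bloch_space \<mu> \<longrightarrow>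
        (let E = ess_norm (log_weight k \<theta>) \<mu> (comp_op \<phi>);
             L1 = limsup (\<lambda>j. bloch_seminorm \<mu> (\<lambda>z. \<phi> z ^ j) /
                              bloch_seminorm (log_weight 1 3) (\<lambda>z. z ^ j));
             L2 = limsup (\<lambda>j. bloch_seminorm \<mu> (\<lambda>z. \<phi> z ^ j) / ennreal (ln (real j + 1)))
         in \<forall>A\<in>{E, L1, L2}. \<forall>B\<in>{E, L1, L2}. equiv_const K A B))"
proof -
  have composition: "log_bloch_composition \<theta> k \<mu> \<phi>"
    if "\<phi> holomorphic_on unit_disc" "\<phi> ` unit_disc \<subseteq> unit_disc" "weight \<mu>" for \<mu> \<phi>
    using that assms by unfold_locales
  have AB: "(bounded_op (log_weight k \<theta>) \<mu> (comp_op \<phi>) \<longleftrightarrow>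
           (SUP j\<in>{1::nat..}. bloch_seminorm \<mu> (\<lambda>z. \<phi> z ^ j) /
                              bloch_seminorm (log_weight 1 3) (\<lambda>z. z ^ j)) < \<infinity>) \<and>
        (bounded_op (log_weight k \<theta>) \<mu> (comp_op \<phi>) \<longleftrightarrow>
           (SUP j\<in>{1::nat..}. bloch_seminorm \<mu> (\<lambda>z. \<phi> z ^ j) / ennreal (ln (real j + 1))) < \<infinity>) \<and>
        (compact_op (log_weight k \<theta>) \<mu> (comp_op \<phi>) \<longleftrightarrow>
           (\<forall>j\<ge>1. bloch_seminorm \<mu> (\<lambda>z. \<phi> z ^ j) / bloch_seminorm (log_weight 1 3) (\<lambda>z. z ^ j) < \<infinity>) \<and>
           (\<lambda>j. bloch_seminorm \<mu> (\<lambda>z. \<phi> z ^ j) / bloch_seminorm (log_weight 1 3) (\<lambda>z. z ^ j)) \<longlonglongrightarrow> 0) \<and>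
        (compact_op (log_weight k \<theta>) \<mu> (comp_op \<phi>) \<longleftrightarrow>
           (\<forall>j\<ge>1. bloch_seminorm \<mu> (\<lambda>z. \<phi> z ^ j) / ennreal (ln (real j + 1)) < \<infinity>) \<and>
           (\<lambda>j. bloch_seminorm \<mu> (\<lambda>z. \<phi> z ^ j) / ennreal (ln (real j + 1))) \<longlonglongrightarrow> 0)"
    if "\<phi> holomorphic_on unit_disc" "\<phi> ` unit_disc \<subseteq> unit_disc" "weight \<mu>" for \<mu> \<phi>
  proof -
    interpret log_bloch_composition \<theta> k \<mu> \<phi> using that by (rule composition)
    show ?thesis
      unfolding norm_ratio_def[symmetric] log_ratio_def[symmetric]
      using bounded_iff_log_ratio compact_iff_log_ratio sup_norm_ratio_iff norm_ratio_finite_iff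
        norm_ratio_null_iff by blast
  qed
  define K where "K = 8 * exp 1 * monomial_bound 3 * monomial_bound \<theta>"
  have K: "0 < K"
    using monomial_bound_ge1[OF assms(1)] monomial_bound_ge1[OF exp_le] by (simp add: K_def)
  have C: "equiv_const K A B"
    if "\<phi> holomorphic_on unit_disc" "\<phi> ` unit_disc \<subseteq> unit_disc" "weight \<mu>"
      "comp_op \<phi> ` bloch_space (log_weight k \<theta>) \<subseteq> bloch_space \<mu>"
      "A \<in> {ess_norm (log_weight k \<theta>) \<mu> (comp_op \<phi>),
         limsup (\<lambda>j. bloch_seminorm \<mu> (\<lambda>z. \<phi> z ^ j) / bloch_seminorm (log_weight 1 3) (\<lambda>z. z ^ j)),
         limsup (\<lambda>j. bloch_seminorm \<mu> (\<lambda>z. \<phi> z ^ j) / ennreal (ln (real j + 1)))}"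
      "B \<in> {ess_norm (log_weight k \<theta>) \<mu> (comp_op \<phi>),
         limsup (\<lambda>j. bloch_seminorm \<mu> (\<lambda>z. \<phi> z ^ j) / bloch_seminorm (log_weight 1 3) (\<lambda>z. z ^ j)),
         limsup (\<lambda>j. bloch_seminorm \<mu> (\<lambda>z. \<phi> z ^ j) / ennreal (ln (real j + 1)))}"
    for \<mu> \<phi> A B
  proof -
    interpret log_bloch_composition \<theta> k \<mu> \<phi> using that(1-3) by (rule composition)
    show ?thesis
      using ess_norm_ratios_equiv[OF that(4), of A B] that(5,6)
      unfolding K_def norm_ratio_def[symmetric] log_ratio_def[symmetric] by blast
  qed
  note AB1 = AB[THEN conjunct1] and AB2 = AB[THEN conjunct2, THEN conjunct1]
    and AB3 = AB[THEN conjunct2, THEN conjunct2, THEN conjunct1]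
    and AB4 = AB[THEN conjunct2, THEN conjunct2, THEN conjunct2]
  show ?thesis
    unfolding Let_def
    apply (rule conjI[OF _ conjI])
    subgoal by (intro allI impI conjI; elim conjE; (rule AB1 | rule AB2); assumption)
    subgoal by (intro allI impI; elim conjE; rule conjI; (rule AB3 | rule AB4); assumption)
    subgoal by (rule exI[of _ K], rule conjI[OF K], intro allI impI ballI; elim conjE; rule C; assumption)
    done
qed

end
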